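(* Let $G$ be an integral distance-regular graph. Then $G$ exhibits perfect state transfer (for the Grover walk) if and only if $G$ is isomorphic to one of $K_2$, $C_4$, $C_6$, or the complete tripartite graph $K_{2,2,2}$.
   Context: A graph is integral if all eigenvalues of its adjacency matrix are integers. A connected graph $G$ is distance-regular if for any vertices $u,v$ the number of vertices at distance $i$ from $u$ and distance $j$ from $v$ depends only on $i,j$ and $\operatorname{dist}(u,v)$. Grover walk: for a finite simple graph $G$ without isolated vertices, arcs $\mathcal{A}(G)=\{(u,v),(v,u):uv\in E(G)\}$, $t((u,v))=v$, $(u,v)^{-1}=(v,u)$; shift $S_{ab}=\delta_{a,b^{-1}}$; boundary $N_{ua}=\frac{1}{\sqrt{\deg u}}\delta_{u,t(a)}$; $U=S(2N^*N-I)$; $\Phi_u=N^*\mathbf{e}_u$. $G$ exhibits perfect state transfer if there exist vertices $u\ne v$, a positive integer $\tau$ and a unimodular $\gamma\in\mathbb{C}$ with $U^\tau\Phi_u=\gamma\Phi_v$. *)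

theory Defs
  imports
    "Graph_Theory.Digraph_Isomorphism"
    "Graph_Theory.Pair_Digraph"
    "Jordan_Normal_Form.Char_Poly"
    "Jordan_Normal_Form.Schur_Decomposition"
    "HOL-Library.Countable_Set"
begin

text \<open>
  A finite simple graph is a \<^emph>\<open>pair_graph\<close> of the library: a finite, loop-free, symmetric
  digraph whose arcs are ordered pairs.  An edge \<open>uv\<close> is thus represented by the two arcs
  \<open>(u,v)\<close> and \<open>(v,u)\<close>, so \<open>parcs G\<close> is the arc set of the Grover walk and the inverse of an
  arc is \<open>prod.swap\<close>.
\<close>

section \<open>Matrices indexed by finite sets\<close>

text \<open>
  The finite sets \<open>R\<close> and \<open>C\<close> indexing rows and columns are numbered by the fixed enumeration
  \<open>from_nat_into\<close> (inverse to \<open>to_nat_on\<close>).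
\<close>

definition mat_on :: "'r set \<Rightarrow> 'c set \<Rightarrow> ('r \<Rightarrow> 'c \<Rightarrow> complex) \<Rightarrow> complex mat" where
  "mat_on R C f =
     mat (card R) (card C) (\<lambda>(i, j). f (from_nat_into R i) (from_nat_into C j))"

definition unit_vec_on :: "'r set \<Rightarrow> 'r \<Rightarrow> complex vec" where
  "unit_vec_on R x = unit_vec (card R) (to_nat_on R x)"

section \<open>Integral and distance-regular graphs\<close>

definition adjacency_mat :: "'a pair_pre_digraph \<Rightarrow> complex mat" where
  "adjacency_mat G =
     mat_on (pverts G) (pverts G) (\<lambda>u v. if (u, v) \<in> parcs G then 1 else 0)"

definition integral_graph :: "'a pair_pre_digraph \<Rightarrow> bool" where
  "integral_graph G \<longleftrightarrow> (\<forall>\<theta>. eigenvalue (adjacency_mat G) \<theta> \<longrightarrow> \<theta> \<in> \<int>)"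

text \<open>Only meaningful for vertices joined by a walk, hence on connected graphs.\<close>

definition graph_dist :: "'a pair_pre_digraph \<Rightarrow> 'a \<Rightarrow> 'a \<Rightarrow> nat" where
  "graph_dist G u v = (LEAST n. \<exists>p. pre_digraph.awalk (with_proj G) u p v \<and> length p = n)"

definition distance_regular :: "'a pair_pre_digraph \<Rightarrow> bool" where
  "distance_regular G \<longleftrightarrow>
     Digraph_Component.connected (with_proj G) \<and>
     (\<forall>i j. \<forall>u\<in>pverts G. \<forall>v\<in>pverts G. \<forall>u'\<in>pverts G. \<forall>v'\<in>pverts G.
        graph_dist G u v = graph_dist G u' v' \<longrightarrow>
        card {w \<in> pverts G. graph_dist G u w = i \<and> graph_dist G v w = j} =
        card {w \<in> pverts G. graph_dist G u' w = i \<and> graph_dist G v' w = j})"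

section \<open>The Grover walk\<close>

definition shift_mat :: "'a pair_pre_digraph \<Rightarrow> complex mat" where
  "shift_mat G = mat_on (parcs G) (parcs G) (\<lambda>a b. if a = prod.swap b then 1 else 0)"

text \<open>The terminus of the arc \<open>a\<close> is \<open>snd a\<close>.\<close>

definition boundary_mat :: "'a pair_pre_digraph \<Rightarrow> complex mat" where
  "boundary_mat G = mat_on (pverts G) (parcs G)
     (\<lambda>u a. if u = snd a then complex_of_real (1 / sqrt (real (out_degree (with_proj G) u))) else 0)"

definition grover_mat :: "'a pair_pre_digraph \<Rightarrow> complex mat" where
  "grover_mat G =
     shift_mat G *
     (2 \<cdot>\<^sub>m (mat_adjoint (boundary_mat G) * boundary_mat G) - 1\<^sub>m (card (parcs G)))"

definition vertex_state :: "'a pair_pre_digraph \<Rightarrow> 'a \<Rightarrow> complex vec" where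
  "vertex_state G u = mat_adjoint (boundary_mat G) *\<^sub>v unit_vec_on (pverts G) u"

definition perfect_state_transfer :: "'a pair_pre_digraph \<Rightarrow> bool" where
  "perfect_state_transfer G \<longleftrightarrow>
     (\<exists>u\<in>pverts G. \<exists>v\<in>pverts G. u \<noteq> v \<and>
        (\<exists>\<tau>::nat. \<tau> > 0 \<and>
          (\<exists>\<gamma>::complex. cmod \<gamma> = 1 \<and>
             (grover_mat G ^\<^sub>m \<tau>) *\<^sub>v vertex_state G u = \<gamma> \<cdot>\<^sub>v vertex_state G v)))"

section \<open>The graphs of the classification\<close>

definition complete_graph :: "nat \<Rightarrow> nat pair_pre_digraph" where
  "complete_graph n =
     \<lparr> pverts = {..<n}, parcs = {(i, j). i < n \<and> j < n \<and> i \<noteq> j} \<rparr>"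

text \<open>Intended for \<open>n \<ge> 3\<close>.\<close>

definition cycle_graph :: "nat \<Rightarrow> nat pair_pre_digraph" where
  "cycle_graph n =
     \<lparr> pverts = {..<n},
       parcs = {(i, j). i < n \<and> j < n \<and> (j = (i + 1) mod n \<or> i = (j + 1) mod n)} \<rparr>"

text \<open>The vertex \<open>(i, k)\<close> is the \<open>k\<close>-th vertex of the \<open>i\<close>-th part; \<open>ns\<close> lists the part sizes.\<close>

definition complete_multipartite_graph :: "nat list \<Rightarrow> (nat \<times> nat) pair_pre_digraph" where
  "complete_multipartite_graph ns =
     (let V = {(i, k). i < length ns \<and> k < ns ! i}
      in \<lparr> pverts = V, parcs = {(x, y). x \<in> V \<and> y \<in> V \<and> fst x \<noteq> fst y} \<rparr>)"

definition graph_iso :: "'a pair_pre_digraph \<Rightarrow> 'b pair_pre_digraph \<Rightarrow> bool" where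
  "graph_iso G H \<longleftrightarrow> digraph_iso (with_proj G) (with_proj H)"

end

theory Submission
  imports Defs
begin

text \<open>
  Let the walk on a \<open>k\<close>-regular graph carry every vertex state \<open>\<Phi>\<^sub>x\<close> to \<open>\<Phi>\<^bsub>\<sigma> x\<^esub>\<close> in time \<open>\<tau>\<close>;
  distance-regularity reduces perfect state transfer to this situation.  Lift a vertex function \<open>f\<close>
  to the arcs, run the walk for \<open>t\<close> steps and average over the arcs ending in a vertex.  The result
  \<open>f\<^sub>t\<close> satisfies \<open>f\<^bsub>t+2\<^esub> + f\<^sub>t = (2/k) A f\<^bsub>t+1\<^esub>\<close>, with \<open>f\<^sub>0 = f\<close>, \<open>f\<^sub>\<tau> = f \<circ> \<sigma>\<close> and period
  \<open>2\<tau>\<close>.  A discrete Fourier transform in \<open>t\<close> splits \<open>f\<close> into eigenvectors of \<open>A\<close> with eigenvalues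
  \<open>k (w + 1/w) / 2\<close>, where \<open>w\<close> is a \<open>2\<tau>\<close>-th root of unity, and composition with \<open>\<sigma>\<close> multiplies each
  of them by \<open>w^\<tau> = \<plusminus>1\<close>.  Integrality and Niven's theorem leave only \<open>w + 1/w \<in> {0, \<plusminus>1, \<plusminus>2}\<close>.
  Inspecting these values gives \<open>A (f \<circ> \<sigma>) = A f\<close> for even \<open>\<tau>\<close>, so that \<open>x\<close> and \<open>\<sigma> x\<close> are twins
  and the graph is a cocktail party graph, with \<open>k = 2\<close> or \<open>k = 4\<close> because of its eigenvalue \<open>-2\<close>.
  For odd \<open>\<tau>\<close> they give \<open>A\<^sup>2 f = (k/2) A (f \<circ> \<sigma>) + (k\<^sup>2/2) f\<close>, whose diagonal forces
  \<open>k = 1\<close> or \<open>k = 2\<close>, and in the latter case the off-diagonal entries force a hexagon.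
\<close>

section \<open>The Grover walk on functions of arcs\<close>

definition vec_on :: "'r set \<Rightarrow> ('r \<Rightarrow> complex) \<Rightarrow> complex vec" where
  "vec_on R f = vec (card R) (\<lambda>i. f (from_nat_into R i))"

lemma vec_on_carrier [simp]: "vec_on R f \<in> carrier_vec (card R)"
  by (simp add: vec_on_def)

lemma mat_on_carrier [simp]: "mat_on R C f \<in> carrier_mat (card R) (card C)"
  by (simp add: mat_on_def)

lemma from_nat_into_image: "finite R \<Longrightarrow> from_nat_into R ` {..<card R} = R"
  by (metis bij_betw_def bij_betw_from_nat_into_finite)

lemma vec_on_eq_iff:
  assumes "finite R"
  shows "vec_on R f = vec_on R g \<longleftrightarrow> (\<forall>r\<in>R. f r = g r)"
proof -
  have "vec_on R f = vec_on R g \<longleftrightarrow> (\<forall>i\<in>{..<card R}. f (from_nat_into R i) = g (from_nat_into R i))"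
    by (auto simp: vec_on_def vec_eq_iff)
  also have "\<dots> \<longleftrightarrow> (\<forall>r\<in>from_nat_into R ` {..<card R}. f r = g r)"
    by blast
  finally show ?thesis
    using assms by (simp add: from_nat_into_image)
qed

lemma mat_on_mult_vec:
  assumes "finite C"
  shows "mat_on R C f *\<^sub>v vec_on C g = vec_on R (\<lambda>r. \<Sum>c\<in>C. f r c * g c)"
proof (rule eq_vecI)
  fix i assume "i < dim_vec (vec_on R (\<lambda>r. \<Sum>c\<in>C. f r c * g c))"
  then have i: "i < card R" by (simp add: vec_on_def)
  have "(\<Sum>j<card C. f (from_nat_into R i) (from_nat_into C j) * g (from_nat_into C j))
      = (\<Sum>c\<in>C. f (from_nat_into R i) c * g c)"
    using sum.reindex_bij_betw[OF bij_betw_from_nat_into_finite[OF assms]] .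
  then show "(mat_on R C f *\<^sub>v vec_on C g) $ i = vec_on R (\<lambda>r. \<Sum>c\<in>C. f r c * g c) $ i"
    using i by (simp add: mat_on_def vec_on_def scalar_prod_def lessThan_atLeast0)
qed (simp add: mat_on_def vec_on_def)

lemma adjoint_mat_on:
  "mat_adjoint (mat_on R C f) = mat_on C R (\<lambda>c r. cnj (f r c))"
  by (rule eq_matI) (auto simp: mat_adjoint_def mat_on_def mat_of_rows_def)

lemma unit_vec_on_conv:
  assumes "finite R" "x \<in> R"
  shows "unit_vec_on R x = vec_on R (\<lambda>r. if r = x then 1 else 0)"
proof (rule eq_vecI)
  fix i assume "i < dim_vec (vec_on R (\<lambda>r. if r = x then 1 else 0))"
  then have i: "i < card R" by (simp add: vec_on_def)
  have "i \<in> to_nat_on R ` R"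
    using i bij_betw_imp_surj_on[OF to_nat_on_finite[OF assms(1)]] by auto
  then have "from_nat_into R i = x \<longleftrightarrow> i = to_nat_on R x"
    using assms countable_finite[OF assms(1)] by (auto simp: from_nat_into_to_nat_on)
  then show "unit_vec_on R x $ i = vec_on R (\<lambda>r. if r = x then 1 else 0) $ i"
    using i by (auto simp: unit_vec_on_def vec_on_def unit_vec_def)
qed (simp add: unit_vec_on_def vec_on_def)

lemma smult_mat_mult_vec:
  fixes M :: "'b :: comm_ring_1 mat"
  assumes "M \<in> carrier_mat m n" "v \<in> carrier_vec n"
  shows "(c \<cdot>\<^sub>m M) *\<^sub>v v = c \<cdot>\<^sub>v (M *\<^sub>v v)"
  using assms by (intro eq_vecI) (auto simp: scalar_prod_def sum_distrib_left mult.assoc)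

text \<open>The operator S(2N*N - I) read entrywise. The shift makes the arc \<open>(x, y)\<close>
  read what is left at \<open>(y, x)\<close>, whose terminus is \<open>x\<close>, and N*N averages
  over the arcs ending there. Their tails are the out-neighbours of \<open>x\<close> when
  \<open>E\<close> is symmetric.\<close>

definition grover :: "('a \<times> 'a) set \<Rightarrow> ('a \<times> 'a \<Rightarrow> complex) \<Rightarrow> 'a \<times> 'a \<Rightarrow> complex" where
  "grover E \<psi> = (\<lambda>(x, y). 2 / of_nat (card (E `` {x})) * (\<Sum>z\<in>E `` {x}. \<psi> (z, x)) - \<psi> (y, x))"

text \<open>The vertex state without its factor 1 / sqrt(deg u).\<close>

definition into :: "'a \<Rightarrow> 'a \<times> 'a \<Rightarrow> complex" where
  "into u a = (if snd a = u then 1 else 0)"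

lemma into_apply: "into u (x, y) = (if y = u then 1 else 0)"
  by (simp add: into_def)

lemma grover_apply:
  "grover E \<psi> (x, y) = 2 / of_nat (card (E `` {x})) * (\<Sum>z\<in>E `` {x}. \<psi> (z, x)) - \<psi> (y, x)"
  by (simp add: grover_def)

context pair_graph
begin

lemma out_degree_conv: "out_degree (with_proj G) u = card (parcs G `` {u})"
proof -
  have "out_arcs (with_proj G) u = Pair u ` (parcs G `` {u})"
    by (auto simp: out_arcs_def)
  then show ?thesis
    by (simp add: out_degree_def card_image inj_on_def)
qed

lemma vertex_state_conv:
  assumes "u \<in> pverts G"
  shows "vertex_state G u =
    vec_on (parcs G) (\<lambda>a. of_real (1 / sqrt (real (card (parcs G `` {u})))) * into u a)"
proof -
  have "vertex_state G u = vec_on (parcs G) (\<lambda>a. \<Sum>r\<in>pverts G.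
     cnj (if r = snd a then complex_of_real (1 / sqrt (real (card (parcs G `` {r})))) else 0)
      * (if r = u then 1 else 0))"
    unfolding vertex_state_def boundary_mat_def adjoint_mat_on out_degree_conv
    using unit_vec_on_conv[OF pair_finite_verts assms] mat_on_mult_vec[OF pair_finite_verts] by simp
  also have "\<dots> = vec_on (parcs G) (\<lambda>a. of_real (1 / sqrt (real (card (parcs G `` {u})))) * into u a)"
    using assms pair_finite_verts
    by (intro arg_cong[where f="vec_on (parcs G)"] ext) (auto simp: into_def if_distrib cong: if_cong)
  finally show ?thesis .
qed

lemma sum_arcs_into:
  assumes "u \<in> pverts G"
  shows "(\<Sum>a\<in>parcs G. if u = snd a then \<psi> a else 0) = (\<Sum>z\<in>parcs G `` {u}. \<psi> (z, u) :: complex)"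
proof -
  have "(\<Sum>a\<in>parcs G. if u = snd a then \<psi> a else 0) = (\<Sum>a\<in>{a \<in> parcs G. u = snd a}. \<psi> a)"
    by (simp add: sum.inter_filter pair_finite_arcs)
  also have "{a \<in> parcs G. u = snd a} = (\<lambda>z. (z, u)) ` (parcs G `` {u})"
    by (auto simp: image_iff intro: arcs_symmetric)
  also have "(\<Sum>a\<in>(\<lambda>z. (z, u)) ` (parcs G `` {u}). \<psi> a) = (\<Sum>z\<in>parcs G `` {u}. \<psi> (z, u))"
    by (subst sum.reindex) (auto simp: inj_on_def)
  finally show ?thesis .
qed

lemma grover_mat_mult_vec:
  "grover_mat G *\<^sub>v vec_on (parcs G) \<psi> = vec_on (parcs G) (grover (parcs G) \<psi>)"
proof -
  let ?A = "parcs G" and ?V = "pverts G"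
  let ?d = "\<lambda>u. complex_of_real (1 / sqrt (real (card (?A `` {u}))))"
  let ?N = "boundary_mat G" and ?v = "vec_on ?A \<psi>"
  let ?m = "card ?A"
  have cN: "?N \<in> carrier_mat (card ?V) ?m" by (simp add: boundary_mat_def)
  have cN': "mat_adjoint ?N \<in> carrier_mat ?m (card ?V)"
    by (simp add: boundary_mat_def adjoint_mat_on)
  have cS: "shift_mat G \<in> carrier_mat ?m ?m" by (simp add: shift_mat_def)
  have cNN: "mat_adjoint ?N * ?N \<in> carrier_mat ?m ?m" using cN cN' by auto
  define \<phi> where "\<phi> = (\<lambda>u. ?d u * (\<Sum>z\<in>?A `` {u}. \<psi> (z, u)))"
  have N: "?N *\<^sub>v ?v = vec_on ?V \<phi>"
    unfolding boundary_mat_def mat_on_mult_vec[OF pair_finite_arcs] out_degree_conv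
      vec_on_eq_iff[OF pair_finite_verts]
  proof
    fix u assume u: "u \<in> ?V"
    have "(\<Sum>c\<in>?A. (if u = snd c then ?d u else 0) * \<psi> c) = (\<Sum>c\<in>?A. if u = snd c then ?d u * \<psi> c else 0)"
      by (intro sum.cong) auto
    also have "\<dots> = \<phi> u"
      using sum_arcs_into[OF u] by (simp add: \<phi>_def sum_distrib_left)
    finally show "(\<Sum>c\<in>?A. (if u = snd c then ?d u else 0) * \<psi> c) = \<phi> u" .
  qed
  have dd: "?d u * ?d u = 1 / of_nat (card (?A `` {u}))" for u
  proof -
    have "?d u * ?d u = complex_of_real (1 / real (card (?A `` {u})))"
      unfolding of_real_mult[symmetric] by simp
    then show ?thesis by simp
  qed
  have NN: "(mat_adjoint ?N * ?N) *\<^sub>v ?v =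
      vec_on ?A (\<lambda>a. (\<Sum>z\<in>?A `` {snd a}. \<psi> (z, snd a)) / of_nat (card (?A `` {snd a})))"
  proof -
    have "(mat_adjoint ?N * ?N) *\<^sub>v ?v = mat_adjoint ?N *\<^sub>v vec_on ?V \<phi>"
      using assoc_mult_mat_vec[OF cN' cN] N by simp
    also have "\<dots> = vec_on ?A (\<lambda>a. \<Sum>r\<in>?V. cnj (if r = snd a then ?d r else 0) * \<phi> r)"
      unfolding boundary_mat_def adjoint_mat_on mat_on_mult_vec[OF pair_finite_verts] out_degree_conv ..
    also have "\<dots> = vec_on ?A (\<lambda>a. (\<Sum>z\<in>?A `` {snd a}. \<psi> (z, snd a)) / of_nat (card (?A `` {snd a})))"
      unfolding vec_on_eq_iff[OF pair_finite_arcs]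
    proof
      fix a assume "a \<in> ?A"
      then have a: "snd a \<in> ?V" by (rule arc_snd_in_verts)
      have "(\<Sum>r\<in>?V. cnj (if r = snd a then ?d r else 0) * \<phi> r) = (\<Sum>r\<in>?V. if r = snd a then ?d r * \<phi> r else 0)"
        by (intro sum.cong) auto
      also have "\<dots> = (?d (snd a) * ?d (snd a)) * (\<Sum>z\<in>?A `` {snd a}. \<psi> (z, snd a))"
        using a pair_finite_verts by (simp add: \<phi>_def)
      finally show "(\<Sum>r\<in>?V. cnj (if r = snd a then ?d r else 0) * \<phi> r) =
          (\<Sum>z\<in>?A `` {snd a}. \<psi> (z, snd a)) / of_nat (card (?A `` {snd a}))"
        by (simp only: dd) simp
    qed
    finally show ?thesis .
  qed
  have "grover_mat G *\<^sub>v ?v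
      = shift_mat G *\<^sub>v ((2 \<cdot>\<^sub>m (mat_adjoint ?N * ?N) - 1\<^sub>m ?m) *\<^sub>v ?v)"
    unfolding grover_mat_def using cS cNN by (intro assoc_mult_mat_vec) auto
  also have "(2 \<cdot>\<^sub>m (mat_adjoint ?N * ?N) - 1\<^sub>m ?m) *\<^sub>v ?v
      = 2 \<cdot>\<^sub>v ((mat_adjoint ?N * ?N) *\<^sub>v ?v) - ?v"
  proof -
    have "(2 \<cdot>\<^sub>m (mat_adjoint ?N * ?N)) *\<^sub>v ?v = 2 \<cdot>\<^sub>v ((mat_adjoint ?N * ?N) *\<^sub>v ?v)"
      using cNN by (rule smult_mat_mult_vec) simp
    then show ?thesis
      using cNN by (subst minus_mult_distrib_mat_vec[where nr="?m" and nc="?m"]) auto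
  qed
  also have "\<dots> = vec_on ?A (\<lambda>a. 2 * ((\<Sum>z\<in>?A `` {snd a}. \<psi> (z, snd a)) / of_nat (card (?A `` {snd a}))) - \<psi> a)"
    unfolding NN by (rule eq_vecI) (auto simp: vec_on_def)
  also have "shift_mat G *\<^sub>v \<dots> = vec_on ?A (grover ?A \<psi>)"
    unfolding shift_mat_def mat_on_mult_vec[OF pair_finite_arcs] vec_on_eq_iff[OF pair_finite_arcs]
  proof
    fix a assume a: "a \<in> ?A"
    then have a': "prod.swap a \<in> ?A" by (cases a) (auto intro: arcs_symmetric)
    let ?g = "\<lambda>a. 2 * ((\<Sum>z\<in>?A `` {snd a}. \<psi> (z, snd a)) / of_nat (card (?A `` {snd a}))) - \<psi> a"
    have "(\<Sum>b\<in>?A. (if a = prod.swap b then 1 else 0) * ?g b) = (\<Sum>b\<in>?A. if b = prod.swap a then ?g b else 0)"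
      by (intro sum.cong) auto
    also have "\<dots> = ?g (prod.swap a)" using a' pair_finite_arcs by simp
    also have "\<dots> = grover ?A \<psi> a" by (cases a) (simp add: grover_def)
    finally show "(\<Sum>b\<in>?A. (if a = prod.swap b then 1 else 0) * ?g b) = grover ?A \<psi> a" .
  qed
  finally show ?thesis .
qed

lemma grover_mat_power_mult_vec:
  "(grover_mat G ^\<^sub>m t) *\<^sub>v vec_on (parcs G) \<psi> = vec_on (parcs G) ((grover (parcs G) ^^ t) \<psi>)"
proof (induction t arbitrary: \<psi>)
  case 0
  then show ?case by (simp add: grover_mat_def shift_mat_def mat_on_def vec_on_def)
next
  case (Suc t)
  have c: "grover_mat G \<in> carrier_mat (card (parcs G)) (card (parcs G))"
    by (auto simp: grover_mat_def shift_mat_def boundary_mat_def adjoint_mat_on mat_on_def)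
  have "(grover_mat G ^\<^sub>m Suc t) *\<^sub>v vec_on (parcs G) \<psi>
      = (grover_mat G ^\<^sub>m t) *\<^sub>v (grover_mat G *\<^sub>v vec_on (parcs G) \<psi>)"
    using c by (simp add: assoc_mult_mat_vec[where ?n\<^sub>1.0="card (parcs G)" and ?n\<^sub>2.0="card (parcs G)" and ?n\<^sub>3.0="card (parcs G)"])
  then show ?case
    by (simp add: grover_mat_mult_vec Suc funpow_swap1)
qed

end

lemma grover_power_mult: "(grover E ^^ t) (\<lambda>a. c * \<psi> a) = (\<lambda>a. c * (grover E ^^ t) \<psi> a)"
  by (induction t) (auto simp: grover_def sum_distrib_left algebra_simps)

text \<open>All vertices share the same normalising factor, so it cancels from the transfer
  equation.\<close>

lemma (in pair_graph) perfect_state_transfer_regular_iff: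
  assumes "\<And>x. x \<in> pverts G \<Longrightarrow> card (parcs G `` {x}) = k" "k > 0"
  shows "perfect_state_transfer G \<longleftrightarrow>
    (\<exists>u\<in>pverts G. \<exists>v\<in>pverts G. u \<noteq> v \<and> (\<exists>\<tau>>0. \<exists>\<gamma>. cmod \<gamma> = 1 \<and>
       (\<forall>a\<in>parcs G. (grover (parcs G) ^^ \<tau>) (into u) a = \<gamma> * into v a)))"
proof -
  have "(grover_mat G ^\<^sub>m \<tau>) *\<^sub>v vertex_state G u = \<gamma> \<cdot>\<^sub>v vertex_state G v \<longleftrightarrow>
      (\<forall>a\<in>parcs G. (grover (parcs G) ^^ \<tau>) (into u) a = \<gamma> * into v a)"
    if "u \<in> pverts G" "v \<in> pverts G" for u v \<tau> \<gamma>
  proof -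
    let ?c = "complex_of_real (1 / sqrt (real k))"
    have c: "?c \<noteq> 0" using assms(2) by simp
    have "\<gamma> \<cdot>\<^sub>v vertex_state G v = vec_on (parcs G) (\<lambda>a. ?c * (\<gamma> * into v a))"
      using that assms by (auto simp: vertex_state_conv vec_on_def intro!: eq_vecI)
    moreover have "(grover_mat G ^\<^sub>m \<tau>) *\<^sub>v vertex_state G u
        = vec_on (parcs G) (\<lambda>a. ?c * (grover (parcs G) ^^ \<tau>) (into u) a)"
      using that assms by (simp only: vertex_state_conv grover_mat_power_mult_vec grover_power_mult)
    ultimately show ?thesis
      using c by (simp only: vec_on_eq_iff[OF pair_finite_arcs] mult_cancel_left) simp
  qed
  then show ?thesis
    unfolding perfect_state_transfer_def by (intro bex_cong refl conj_cong ex_cong1) auto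
qed

lemma (in pair_graph) integral_graph_eigenvalue:
  assumes "integral_graph G" and f: "x \<in> pverts G" "f x \<noteq> (0 :: complex)"
    and eig: "\<And>x. x \<in> pverts G \<Longrightarrow> (\<Sum>y\<in>parcs G `` {x}. f y) = \<theta> * f x"
  shows "\<theta> \<in> \<int>"
proof -
  let ?V = "pverts G"
  have "adjacency_mat G *\<^sub>v vec_on ?V f = \<theta> \<cdot>\<^sub>v vec_on ?V f"
  proof -
    have "adjacency_mat G *\<^sub>v vec_on ?V f = vec_on ?V (\<lambda>x. \<theta> * f x)"
      unfolding adjacency_mat_def mat_on_mult_vec[OF pair_finite_verts] vec_on_eq_iff[OF pair_finite_verts]
    proof
      fix x assume x: "x \<in> ?V"
      have "(\<Sum>y\<in>?V. (if (x, y) \<in> parcs G then 1 else 0) * f y) = (\<Sum>y\<in>?V. if (x, y) \<in> parcs G then f y else 0)"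
        by (intro sum.cong) auto
      also have "\<dots> = (\<Sum>y\<in>{y \<in> ?V. (x, y) \<in> parcs G}. f y)"
        by (simp add: sum.inter_filter pair_finite_verts)
      also have "{y \<in> ?V. (x, y) \<in> parcs G} = parcs G `` {x}"
        by (auto dest: in_arcsD2)
      finally show "(\<Sum>y\<in>?V. (if (x, y) \<in> parcs G then 1 else 0) * f y) = \<theta> * f x"
        using eig[OF x] by simp
    qed
    then show ?thesis by (auto simp: vec_on_def)
  qed
  moreover have "vec_on ?V f \<noteq> 0\<^sub>v (card ?V)"
  proof -
    have "0\<^sub>v (card ?V) = vec_on ?V (\<lambda>_. 0)" by (auto simp: vec_on_def)
    then show ?thesis using f by (auto simp: vec_on_eq_iff[OF pair_finite_verts])
  qed
  ultimately have "eigenvalue (adjacency_mat G) \<theta>"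
    unfolding eigenvalue_def eigenvector_def
    by (intro exI[of _ "vec_on ?V f"]) (simp add: adjacency_mat_def mat_on_def vec_on_def)
  then show ?thesis using assms(1) by (simp add: integral_graph_def)
qed

text \<open>The walk compressed to the cells of an equitable partition: \<open>b i l\<close> counts
  the neighbours in cell \<open>l\<close> of a vertex of cell \<open>i\<close>, and the value at
  \<open>i j\<close> is the amplitude on an arc from cell \<open>i\<close> to cell \<open>j\<close>.
  The start is on the arcs into cell 0.\<close>

fun quotient_walk :: "nat \<Rightarrow> nat \<Rightarrow> (nat \<Rightarrow> nat \<Rightarrow> nat) \<Rightarrow> nat \<Rightarrow> nat \<Rightarrow> nat \<Rightarrow> complex" where
  "quotient_walk k n b 0 i j = (if j = 0 then 1 else 0)"
| "quotient_walk k n b (Suc t) i j =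
     2 / of_nat k * (\<Sum>l\<le>n. of_nat (b i l) * quotient_walk k n b t l i) - quotient_walk k n b t j i"

context pair_graph
begin

abbreviation nbrs :: "'a \<Rightarrow> 'a set" where
  "nbrs x \<equiv> parcs G `` {x}"

lemma finite_nbrs [simp]: "finite (nbrs x)"
  using pair_finite_arcs by (rule finite_Image)

lemma nbrs_subset: "nbrs x \<subseteq> pverts G"
  by (auto dest: in_arcsD2)

text \<open>By induction all arcs from one cell to another carry equal amplitude, since the incoming
  sum at a vertex depends only on how many of its neighbours lie in each cell. The hypothesis
  \<open>root\<close> makes cell 0 the singleton of the source, which settles time 0.\<close>

lemma grover_power_quotient:
  assumes cells: "\<And>x j. x \<in> pverts G \<Longrightarrow> card {z \<in> nbrs x. c z = j} = b (c x) j"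
    and bound: "\<And>x. x \<in> pverts G \<Longrightarrow> c x \<le> n"
    and root: "\<And>x. x \<in> pverts G \<Longrightarrow> c x = 0 \<longleftrightarrow> x = u"
    and regular: "\<And>x. x \<in> pverts G \<Longrightarrow> card (nbrs x) = k"
    and arc: "(x, y) \<in> parcs G"
  shows "(grover (parcs G) ^^ t) (into u) (x, y) = quotient_walk k n b t (c x) (c y)"
  using arc
proof (induction t arbitrary: x y)
  case 0
  then show ?case using root[of y] by (auto simp: into_def dest: in_arcsD2)
next
  case (Suc t)
  let ?q = "quotient_walk k n b t"
  have x: "x \<in> pverts G" using Suc.prems by (rule in_arcsD1)
  have "(\<Sum>z\<in>nbrs x. (grover (parcs G) ^^ t) (into u) (z, x)) = (\<Sum>z\<in>nbrs x. ?q (c z) (c x))"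
    by (intro sum.cong refl Suc.IH) (auto intro: arcs_symmetric)
  also have "\<dots> = (\<Sum>l\<le>n. \<Sum>z\<in>{z \<in> nbrs x. c z = l}. ?q (c z) (c x))"
    using bound nbrs_subset[of x] by (subst sum.group) auto
  also have "\<dots> = (\<Sum>l\<le>n. of_nat (b (c x) l) * ?q l (c x))"
  proof (intro sum.cong refl)
    fix l
    have "(\<Sum>z\<in>{z \<in> nbrs x. c z = l}. ?q (c z) (c x)) = of_nat (card {z \<in> nbrs x. c z = l}) * ?q l (c x)"
      by simp
    then show "(\<Sum>z\<in>{z \<in> nbrs x. c z = l}. ?q (c z) (c x)) = of_nat (b (c x) l) * ?q l (c x)"
      by (simp only: cells[OF x])
  qed
  finally have "(\<Sum>z\<in>nbrs x. (grover (parcs G) ^^ t) (into u) (z, x)) = \<dots>" .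
  moreover have "(grover (parcs G) ^^ t) (into u) (y, x) = ?q (c y) (c x)"
    using Suc.prems by (rule Suc.IH[OF arcs_symmetric])
  ultimately show ?case
    using regular[OF x] by (simp add: grover_apply)
qed

section \<open>Conservation of the total amplitude\<close>

lemma sum_arcs: "(\<Sum>a\<in>parcs G. \<psi> a) = (\<Sum>x\<in>pverts G. \<Sum>y\<in>nbrs x. \<psi> (x, y) :: complex)"
proof -
  have "parcs G = Sigma (pverts G) nbrs"
    by (auto dest: in_arcsD1)
  then show ?thesis
    using pair_finite_verts by (simp add: sum.Sigma)
qed

lemma sum_arcs_swap: "(\<Sum>a\<in>parcs G. \<psi> (prod.swap a)) = (\<Sum>a\<in>parcs G. \<psi> a :: complex)"
  by (rule sum.reindex_bij_witness[of _ prod.swap prod.swap]) (auto intro: arcs_symmetric)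

text \<open>Reflection about the mean preserves the incoming sum S at each vertex, as 2S - S = S;
  the shift only permutes the arcs.\<close>

lemma sum_grover:
  assumes "\<And>x. x \<in> pverts G \<Longrightarrow> card (nbrs x) = k" "k > 0"
  shows "(\<Sum>a\<in>parcs G. grover (parcs G) \<psi> a) = (\<Sum>a\<in>parcs G. \<psi> a)"
proof -
  have "(\<Sum>y\<in>nbrs x. grover (parcs G) \<psi> (x, y)) = (\<Sum>y\<in>nbrs x. \<psi> (y, x))" if "x \<in> pverts G" for x
    using assms that by (simp add: grover_apply sum_subtractf)
  then have "(\<Sum>a\<in>parcs G. grover (parcs G) \<psi> a) = (\<Sum>x\<in>pverts G. \<Sum>y\<in>nbrs x. \<psi> (y, x))"
    by (simp add: sum_arcs)
  also have "\<dots> = (\<Sum>a\<in>parcs G. \<psi> (prod.swap a))"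
    by (simp add: sum_arcs)
  finally show ?thesis by (simp add: sum_arcs_swap)
qed

lemma sum_grover_power:
  assumes "\<And>x. x \<in> pverts G \<Longrightarrow> card (nbrs x) = k" "k > 0"
  shows "(\<Sum>a\<in>parcs G. (grover (parcs G) ^^ t) \<psi> a) = (\<Sum>a\<in>parcs G. \<psi> a)"
  by (induction t) (simp_all add: sum_grover[OF assms])

lemma sum_into:
  assumes "u \<in> pverts G"
  shows "(\<Sum>a\<in>parcs G. into u a) = of_nat (card (nbrs u))"
proof -
  have "into u = (\<lambda>a. if u = snd a then 1 else 0)" by (auto simp: into_def)
  then show ?thesis using sum_arcs_into[OF assms, of "\<lambda>_. 1"] by simp
qed

section \<open>Distance through powers of the arc relation\<close>

lemma awalk_relpow_iff:
  assumes "u \<in> pverts G"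
  shows "(\<exists>p. awalk u p v \<and> length p = n) \<longleftrightarrow> (u, v) \<in> parcs G ^^ n"
  using assms
proof (induction n arbitrary: u)
  case 0
  then show ?case by (auto simp: awalk_Nil_iff)
next
  case (Suc n)
  have "(\<exists>p. awalk u p v \<and> length p = Suc n) \<longleftrightarrow>
      (\<exists>w. (u, w) \<in> parcs G \<and> (\<exists>p. awalk w p v \<and> length p = n))"
    by (auto simp: length_Suc_conv awalk_Cons_iff) (metis awalk_Cons_iff fst_conv snd_conv)+
  also have "\<dots> \<longleftrightarrow> (\<exists>w. (u, w) \<in> parcs G \<and> (w, v) \<in> parcs G ^^ n)"
    using Suc.IH by (blast dest: in_arcsD2)
  also have "\<dots> \<longleftrightarrow> (u, v) \<in> parcs G ^^ Suc n"
    by (metis relpow_Suc_D2 relpow_Suc_I2)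
  finally show ?case .
qed

lemma graph_dist_conv:
  "u \<in> pverts G \<Longrightarrow> graph_dist G u v = (LEAST n. (u, v) \<in> parcs G ^^ n)"
  by (simp add: graph_dist_def awalk_relpow_iff)

lemma relpow_sym: "(u, v) \<in> parcs G ^^ n \<Longrightarrow> (v, u) \<in> parcs G ^^ n"
proof (induction n arbitrary: u)
  case (Suc n)
  then obtain w where "(u, w) \<in> parcs G" "(w, v) \<in> parcs G ^^ n"
    by (meson relpow_Suc_D2)
  then show ?case using Suc.IH arcs_symmetric by auto
qed simp

end

section \<open>State transfer in distance-regular graphs\<close>

locale distance_regular_graph = pair_graph +
  assumes distance_regular: "distance_regular G"
begin

section \<open>Distances, spheres and intersection numbers\<close>

abbreviation dist :: "'a \<Rightarrow> 'a \<Rightarrow> nat" where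
  "dist \<equiv> graph_dist G"

lemma relpow_dist:
  assumes "u \<in> pverts G" "v \<in> pverts G"
  shows "(u, v) \<in> parcs G ^^ dist u v"
proof -
  have "Digraph_Component.connected (with_proj G)"
    using distance_regular by (simp add: distance_regular_def)
  then have "strongly_connected (with_proj G)"
    using symmetric_connected_imp_strongly_connected sym_arcs by blast
  then have "u \<rightarrow>\<^sup>*\<^bsub>with_proj G\<^esub> v"
    using assms by (auto simp: strongly_connected_def)
  then have "\<exists>p. awalk u p v"
    by (simp add: reachable_awalk)
  then have "\<exists>n. (u, v) \<in> parcs G ^^ n"
    using awalk_relpow_iff[OF assms(1)] by blast
  then show ?thesis
    using assms(1) by (auto simp: graph_dist_conv intro: LeastI)
qed

lemma dist_le: "u \<in> pverts G \<Longrightarrow> (u, v) \<in> parcs G ^^ n \<Longrightarrow> dist u v \<le> n"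
  by (simp add: graph_dist_conv Least_le)

lemma dist_commute: "u \<in> pverts G \<Longrightarrow> v \<in> pverts G \<Longrightarrow> dist u v = dist v u"
  by (meson dist_le le_antisym relpow_dist relpow_sym)

lemma dist_eq_0_iff: "u \<in> pverts G \<Longrightarrow> v \<in> pverts G \<Longrightarrow> dist u v = 0 \<longleftrightarrow> u = v"
  using relpow_dist[of u v] dist_le[of u v 0] by auto

lemma dist_eq_1_iff:
  assumes "u \<in> pverts G" "v \<in> pverts G"
  shows "dist u v = 1 \<longleftrightarrow> (u, v) \<in> parcs G"
proof
  assume "dist u v = 1"
  then show "(u, v) \<in> parcs G"
    using relpow_dist[OF assms] by simp
next
  assume *: "(u, v) \<in> parcs G"
  then have "dist u v \<le> 1" using dist_le[OF assms(1), of v 1] by simp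
  moreover have "dist u v \<noteq> 0"
    using * assms no_loops' by (auto simp: dist_eq_0_iff)
  ultimately show "dist u v = 1" by simp
qed

text \<open>The last but one vertex of a shortest walk: were it closer to \<open>u\<close> than
  \<open>n\<close>, one more arc would reach \<open>v\<close> too early.\<close>

lemma dist_predecessor:
  assumes "u \<in> pverts G" "v \<in> pverts G" "dist u v = Suc n"
  obtains x where "(x, v) \<in> parcs G" "dist u x = n"
proof -
  have "(u, v) \<in> parcs G ^^ Suc n"
    using relpow_dist[OF assms(1,2)] assms(3) by simp
  then obtain x where x: "(u, x) \<in> parcs G ^^ n" "(x, v) \<in> parcs G" by auto
  then have "(u, x) \<in> parcs G ^^ dist u x"
    using assms(1) by (meson in_arcsD1 relpow_dist)
  then have "(u, v) \<in> parcs G ^^ Suc (dist u x)"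
    using x by auto
  then have "Suc n \<le> Suc (dist u x)"
    using dist_le[OF assms(1)] assms(3) by metis
  moreover have "dist u x \<le> n"
    using x dist_le[OF assms(1)] by blast
  ultimately show ?thesis using x that by force
qed

lemma intersection_card:
  assumes "u \<in> pverts G" "v \<in> pverts G" "u' \<in> pverts G" "v' \<in> pverts G" "dist u v = dist u' v'"
  shows "card {w \<in> pverts G. dist u w = i \<and> dist v w = j}
    = card {w \<in> pverts G. dist u' w = i \<and> dist v' w = j}"
  using distance_regular assms unfolding distance_regular_def by blast

lemma sphere_card:
  assumes "u \<in> pverts G" "v \<in> pverts G"
  shows "card {w \<in> pverts G. dist u w = i} = card {w \<in> pverts G. dist v w = i}"
  using intersection_card[of u u v v i i] assms by (simp add: dist_eq_0_iff[THEN iffD2])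

lemma nbrs_dist: "x \<in> pverts G \<Longrightarrow> nbrs x = {w \<in> pverts G. dist x w = 1}"
  using dist_eq_1_iff by (auto dest: in_arcsD2)

lemma regular:
  assumes "x \<in> pverts G" "y \<in> pverts G"
  shows "card (nbrs x) = card (nbrs y)"
  using sphere_card[OF assms, of 1] assms by (simp only: nbrs_dist)

text \<open>One table serves every root \<open>u\<close>: a pair of vertices is chosen for each
  distance, and distance-regularity makes the count independent of the choice. So the distance
  partitions from all vertices are equitable with the same quotient.\<close>

lemma exists_intersection_numbers:
  "\<exists>b. \<forall>u\<in>pverts G. \<forall>x\<in>pverts G. \<forall>j. card {z \<in> nbrs x. dist u z = j} = b (dist u x) j"
proof -
  define P where "P = (\<lambda>i (u, x). u \<in> pverts G \<and> x \<in> pverts G \<and> dist u x = i)"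
  define b where "b = (\<lambda>i j. case SOME p. P i p of (u, x) \<Rightarrow> card {z \<in> nbrs x. dist u z = j})"
  have "card {z \<in> nbrs x. dist u z = j} = b (dist u x) j"
    if ux: "u \<in> pverts G" "x \<in> pverts G" for u x j
  proof -
    obtain u' x' where p: "(SOME p. P (dist u x) p) = (u', x')" by fastforce
    have "P (dist u x) (u, x)" using ux by (simp add: P_def)
    then have "P (dist u x) (u', x')" unfolding p[symmetric] by (rule someI)
    then have ux': "u' \<in> pverts G" "x' \<in> pverts G" "dist u' x' = dist u x"
      by (auto simp: P_def)
    have "{z \<in> nbrs x. dist u z = j} = {w \<in> pverts G. dist u w = j \<and> dist x w = 1}"
      "{z \<in> nbrs x'. dist u' z = j} = {w \<in> pverts G. dist u' w = j \<and> dist x' w = 1}"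
      using ux ux' by (auto simp: nbrs_dist)
    then show ?thesis
      using intersection_card[OF ux ux'(1,2), of j 1] ux'(3) by (simp add: b_def p)
  qed
  then show ?thesis by blast
qed

text \<open>By distance-regularity the amplitude at an arc of the walk started at \<open>u\<close> depends only on the
  distances from \<open>u\<close> to the two ends, so that transfer from one vertex implies transfer from every
  vertex \<open>x\<close>, namely to the only vertex \<open>\<sigma> x\<close> at a certain distance from \<open>x\<close>.  The phase is \<open>1\<close>
  because the walk on a regular graph preserves the sum of the amplitudes.\<close>

lemma perfect_state_transfer_involution:
  assumes "perfect_state_transfer G"
  obtains \<sigma> \<tau> k where "k > 0" "\<And>x. x \<in> pverts G \<Longrightarrow> card (nbrs x) = k" "\<tau> > 0"
    "\<And>x. x \<in> pverts G \<Longrightarrow> \<sigma> x \<in> pverts G"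
    "\<And>x. x \<in> pverts G \<Longrightarrow> \<sigma> (\<sigma> x) = x"
    "\<And>x. x \<in> pverts G \<Longrightarrow> \<sigma> x \<noteq> x"
    "\<And>x y. x \<in> pverts G \<Longrightarrow> y \<in> pverts G \<Longrightarrow> dist x y = dist x (\<sigma> x) \<longleftrightarrow> y = \<sigma> x"
    "\<And>x a. x \<in> pverts G \<Longrightarrow> a \<in> parcs G \<Longrightarrow> (grover (parcs G) ^^ \<tau>) (into x) a = into (\<sigma> x) a"
proof -
  let ?V = "pverts G"
  obtain u0 v0 where uv0: "u0 \<in> ?V" "v0 \<in> ?V" "u0 \<noteq> v0"
    using assms by (auto simp: perfect_state_transfer_def)
  define k where "k = card (nbrs v0)"
  have reg: "card (nbrs x) = k" if "x \<in> ?V" for x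
    using regular[OF that uv0(2)] by (simp add: k_def)
  \<comment> \<open>Two distinct vertices of a connected graph force an arc, so the common degree is
    positive.\<close>
  have "dist u0 v0 \<noteq> 0" using uv0 by (simp add: dist_eq_0_iff)
  then obtain n0 where "dist u0 v0 = Suc n0" by (auto simp: gr0_conv_Suc)
  then obtain x0 where "(x0, v0) \<in> parcs G" using dist_predecessor uv0 by metis
  then have "x0 \<in> nbrs v0" by (auto intro: arcs_symmetric)
  then have k: "k > 0" unfolding k_def by (auto simp: card_gt_0_iff)
  obtain u v \<tau> \<gamma> where uv: "u \<in> ?V" "v \<in> ?V" "u \<noteq> v" and \<tau>: "\<tau> > 0" and \<gamma>: "cmod \<gamma> = 1"
    and pst: "\<And>a. a \<in> parcs G \<Longrightarrow> (grover (parcs G) ^^ \<tau>) (into u) a = \<gamma> * into v a"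
    using assms perfect_state_transfer_regular_iff[OF reg k] by blast
  obtain b where b: "\<And>u x j. u \<in> ?V \<Longrightarrow> x \<in> ?V \<Longrightarrow> card {z \<in> nbrs x. dist u z = j} = b (dist u x) j"
    using exists_intersection_numbers by blast
  define n where "n = Max ((\<lambda>(x, y). dist x y) ` (?V \<times> ?V))"
  have n: "dist x y \<le> n" if "x \<in> ?V" "y \<in> ?V" for x y
    unfolding n_def using that pair_finite_verts by (intro Max_ge) auto
  define q where "q = quotient_walk k n b \<tau>"
  have walk: "(grover (parcs G) ^^ \<tau>) (into x) (y, z) = q (dist x y) (dist x z)"
    if "x \<in> ?V" "(y, z) \<in> parcs G" for x y z
    unfolding q_def using that b n reg
    by (intro grover_power_quotient) (auto simp: dist_eq_0_iff)
  have q: "q (dist u y) (dist u z) = \<gamma> * (if z = v then 1 else 0)" if "(y, z) \<in> parcs G" for y z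
    using walk[OF uv(1) that] pst[OF that] by (simp add: into_def)
  define m where "m = dist u v"
  have "m \<noteq> 0" using uv by (simp add: m_def dist_eq_0_iff)
  then obtain m' where m': "m = Suc m'" by (auto simp: gr0_conv_Suc)
  \<comment> \<open>The last arcs of shortest walks from \<open>u\<close> to \<open>w\<close> and to
    \<open>v\<close> join the same pair of distance cells, hence carry the same amplitude. At
    \<open>v\<close> it is the nonzero \<gamma>, so \<open>w\<close> is \<open>v\<close>.\<close>
  have target: "dist u w = m \<longleftrightarrow> w = v" if w: "w \<in> ?V" for w
  proof
    assume d: "dist u w = m"
    obtain x where x: "(x, w) \<in> parcs G" "dist u x = m'"
      using dist_predecessor[of u w m'] uv w d m' by metis
    obtain x' where x': "(x', v) \<in> parcs G" "dist u x' = m'"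
      using dist_predecessor[of u v m'] uv m' m_def by metis
    have "\<gamma> * (if w = v then 1 else 0) = \<gamma>"
      using q[OF x(1)] q[OF x'(1)] x(2) x'(2) d by (simp add: m_def)
    then show "w = v" using \<gamma> by (auto split: if_splits)
  qed (simp add: m_def)
  have "{w \<in> ?V. dist u w = m} = {v}" using target uv by auto
  then have sphere: "card {w \<in> ?V. dist x w = m} = 1" if "x \<in> ?V" for x
    using sphere_card[OF that uv(1), of m] by simp
  define \<sigma> where "\<sigma> = (\<lambda>x. THE y. y \<in> ?V \<and> dist x y = m)"
  have \<sigma>: "y \<in> ?V \<and> dist x y = m \<longleftrightarrow> y = \<sigma> x" if x: "x \<in> ?V" for x y
  proof -
    obtain y0 where "{w \<in> ?V. dist x w = m} = {y0}"
      using sphere[OF x] by (meson card_1_singletonE)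
    then have y0: "y \<in> ?V \<and> dist x y = m \<longleftrightarrow> y = y0" for y by blast
    then have "\<sigma> x = y0" unfolding \<sigma>_def by simp
    then show ?thesis using y0 by simp
  qed
  have \<sigma>V: "\<sigma> x \<in> ?V" and d\<sigma>: "dist x (\<sigma> x) = m" if "x \<in> ?V" for x
    using \<sigma>[OF that] by blast+
  \<comment> \<open>The arc is copied to one in the same position relative to \<open>u\<close>,
    where the amplitude is known; \<open>q\<close> gives both the same value.\<close>
  have transfer: "(grover (parcs G) ^^ \<tau>) (into x) a = \<gamma> * into (\<sigma> x) a"
    if x: "x \<in> ?V" and a: "a \<in> parcs G" for x a
  proof -
    obtain y z where yz: "a = (y, z)" by fastforce
    have y: "y \<in> ?V" "z \<in> ?V" using a yz by (auto dest: in_arcsD1 in_arcsD2)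
    have "0 < card {w \<in> ?V. dist x w = dist x y}"
      using y pair_finite_verts by (auto simp: card_gt_0_iff)
    then have "0 < card {w \<in> ?V. dist u w = dist x y}"
      by (simp only: sphere_card[OF x uv(1)])
    then obtain y' where y': "y' \<in> ?V" "dist u y' = dist x y"
      by (auto simp: card_gt_0_iff)
    have "0 < card {w \<in> nbrs y. dist x w = dist x z}"
      using a yz finite_subset[of "{w \<in> nbrs y. dist x w = dist x z}" "nbrs y"]
      by (auto simp: card_gt_0_iff)
    then have "0 < card {w \<in> nbrs y'. dist u w = dist x z}"
      by (simp only: b[OF x y(1)] b[OF uv(1) y'(1)] y'(2))
    then obtain z' where z': "z' \<in> nbrs y'" "dist u z' = dist x z"
      by (auto simp: card_gt_0_iff)
    have z'V: "z' \<in> ?V" using z' by (auto dest: in_arcsD2)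
    have "(grover (parcs G) ^^ \<tau>) (into x) a = q (dist u y') (dist u z')"
      using walk[OF x] a yz y' z' by simp
    also have "\<dots> = \<gamma> * (if z' = v then 1 else 0)"
      using q[of y' z'] z' by simp
    also have "z' = v \<longleftrightarrow> z = \<sigma> x"
      using target[OF z'V] \<sigma>[OF x, of z] y z' by simp
    finally show ?thesis by (simp add: into_apply yz)
  qed
  have "\<gamma> = 1"
  proof -
    have "of_nat k = (\<Sum>a\<in>parcs G. (grover (parcs G) ^^ \<tau>) (into u) a)"
      using sum_grover_power[OF reg k] uv reg by (simp add: sum_into)
    also have "\<dots> = \<gamma> * of_nat k"
      using pst uv reg by (simp add: sum_into flip: sum_distrib_left)
    finally show ?thesis using k by simp
  qed
  show ?thesis
  proof (rule that[of k \<tau> \<sigma>])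
    fix x assume x: "x \<in> ?V"
    have "dist (\<sigma> x) x = m" using dist_commute x \<sigma>V d\<sigma> by metis
    then show "\<sigma> (\<sigma> x) = x" using \<sigma>[OF \<sigma>V[OF x], of x] x by simp
    show "\<sigma> x \<noteq> x" using d\<sigma>[OF x] \<open>m \<noteq> 0\<close> dist_eq_0_iff[OF x x] by auto
  next
    fix x y assume "x \<in> ?V" "y \<in> ?V"
    then show "dist x y = dist x (\<sigma> x) \<longleftrightarrow> y = \<sigma> x" using \<sigma>[of x y] d\<sigma>[of x] by simp
  qed (use k reg \<tau> \<sigma>V d\<sigma> transfer \<open>\<gamma> = 1\<close> in auto)
qed

end

section \<open>Roots of unity\<close>

text \<open>Multiplication by a root \<open>z\<close> with \<open>z ^ s\<close> different from 1
  permutes the roots and scales the sum by \<open>z ^ s\<close>, so the sum vanishes.\<close>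

lemma sum_roots_unity_power:
  assumes "n > 0"
  shows "(\<Sum>w | w ^ n = 1. w ^ s) = (if n dvd s then of_nat n else (0 :: complex))"
proof (cases "n dvd s")
  case True
  then obtain q where "s = n * q" by blast
  then have "(\<Sum>w | w ^ n = 1. w ^ s :: complex) = (\<Sum>w | (w :: complex) ^ n = 1. 1 :: complex)"
    by (intro sum.cong refl) (simp add: power_mult)
  then show ?thesis
    using True assms by (simp add: card_roots_unity_eq)
next
  case False
  let ?R = "{w :: complex. w ^ n = 1}" and ?r = "s mod n"
  have r: "0 < ?r" "?r < n" using False assms by (auto simp: dvd_eq_mod_eq_0)
  have pow: "w ^ s = w ^ ?r" if "w ^ n = 1" for w :: complex
  proof -
    have "w ^ s = (w ^ n) ^ (s div n) * w ^ ?r"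
      by (simp flip: power_mult power_add)
    then show ?thesis using that by simp
  qed
  \<comment> \<open>Only \<open>?r < n\<close> complex numbers satisfy \<open>w ^ ?r = 1\<close>, so
    some \<open>n\<close>-th root of unity does not.\<close>
  have "\<not> ?R \<subseteq> {w. w ^ ?r = 1}"
  proof
    assume "?R \<subseteq> {w. w ^ ?r = 1}"
    then have "card ?R \<le> card {w :: complex. w ^ ?r = 1}"
      using r by (intro card_mono finite_roots_unity) auto
    then show False using r assms by (simp add: card_roots_unity_eq)
  qed
  then obtain z :: complex where z: "z ^ n = 1" "z ^ ?r \<noteq> 1" by blast
  then have z0: "z \<noteq> 0" using assms by (auto simp: power_0_left)
  have "(\<Sum>w | w ^ n = 1. w ^ s) = (\<Sum>w | w ^ n = 1. (z * w) ^ s)"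
    using z z0 by (intro sum.reindex_bij_witness[of _ "\<lambda>w. z * w" "\<lambda>w. w / z"])
      (auto simp: power_mult_distrib power_divide)
  also have "\<dots> = z ^ ?r * (\<Sum>w | w ^ n = 1. w ^ s)"
    using z by (simp add: power_mult_distrib sum_distrib_left pow)
  finally have "(\<Sum>w | w ^ n = 1. w ^ s) = (0 :: complex)"
    using z by auto
  then show ?thesis using False by simp
qed

text \<open>If \<open>w\<close> is an \<open>n\<close>-th root of unity, then \<open>w + 1 / w\<close> is a root of \<open>dickson n - 2\<close>, hence an
  algebraic integer.\<close>

fun dickson :: "nat \<Rightarrow> complex poly" where
  "dickson 0 = [:2:]"
| "dickson (Suc 0) = [:0, 1:]"
| "dickson (Suc (Suc n)) = pCons 0 (dickson (Suc n)) - dickson n"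

lemma poly_dickson:
  assumes "w \<noteq> 0"
  shows "poly (dickson n) (w + 1 / w) = w ^ n + 1 / w ^ n"
  using assms by (induction n rule: dickson.induct) (auto simp: field_simps)

lemma coeff_dickson_Ints: "coeff (dickson n) i \<in> \<int>"
  by (induction n arbitrary: i rule: dickson.induct) (auto simp: coeff_pCons split: nat.split)

lemma coeff_dickson_eq_0: "i > n \<Longrightarrow> coeff (dickson n) i = 0"
  by (induction n arbitrary: i rule: dickson.induct) (auto simp: coeff_pCons split: nat.split)

lemma coeff_dickson_monic: "n > 0 \<Longrightarrow> coeff (dickson n) n = 1"
  by (induction n rule: dickson.induct) (auto simp: coeff_dickson_eq_0)

text \<open>A rational algebraic integer is an integer, and \<open>w\<close> lies on the unit
  circle, which bounds the trace by 2 in absolute value.\<close>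

lemma Niven_theorem:
  fixes w :: complex
  assumes n: "n > 0" and w: "w ^ n = 1" and rat: "w + 1 / w \<in> \<rat>"
  shows "w + 1 / w \<in> {-2, -1, 0, 1, 2}"
proof -
  let ?p = "dickson n - [:2:]"
  have w0: "w \<noteq> 0" using n w by (auto simp: power_0_left)
  have lead: "coeff ?p n = 1"
    using n coeff_dickson_monic[OF n] by (simp add: coeff_pCons split: nat.split)
  have "degree ?p = n"
  proof (rule antisym)
    show "degree ?p \<le> n"
      by (rule degree_le) (auto simp: coeff_dickson_eq_0 coeff_pCons split: nat.split)
    show "n \<le> degree ?p" using lead by (intro le_degree) simp
  qed
  then have "lead_coeff ?p = 1" using lead by simp
  moreover have "coeff ?p i \<in> \<int>" for i
    by (auto simp: coeff_pCons coeff_dickson_Ints split: nat.split)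
  moreover have "poly ?p (w + 1 / w) = 0"
    using poly_dickson[OF w0, of n] w by simp
  ultimately have "algebraic_int (w + 1 / w)"
    by (intro algebraic_int.intros) blast+
  then have "w + 1 / w \<in> \<int>" using rat by (rule rational_algebraic_int_is_int)
  then obtain i where i: "w + 1 / w = of_int i" by (auto elim: Ints_cases)
  have "cmod w = 1" using power_eq_1_iff[OF w] n by simp
  then have "cmod (w + 1 / w) \<le> 2"
    using norm_triangle_ineq[of w "1 / w"] by (simp add: norm_divide)
  then have "\<bar>i\<bar> \<le> 2" unfolding i by simp
  then have "i \<in> {-2, -1, 0, 1, 2}" by auto
  then show ?thesis unfolding i by auto
qed

text \<open>The trace s fixes the equation w^2 - s w + 1 = 0: a double root for s = 2 and s = -2,
  and the cyclotomic polynomials of orders 4, 6 and 3 for s equal to 0, 1 and -1.\<close>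

lemma trace_cases:
  fixes w :: complex
  assumes "w \<noteq> 0"
  shows "w + 1 / w = 2 \<Longrightarrow> w = 1" "w + 1 / w = -2 \<Longrightarrow> w = -1"
    "w + 1 / w = 0 \<Longrightarrow> w ^ 2 = -1" "w + 1 / w = 1 \<Longrightarrow> w ^ 3 = -1" "w + 1 / w = -1 \<Longrightarrow> w ^ 3 = 1"
proof -
  have eq: "w * (w + 1 / w) = w ^ 2 + 1"
    using assms by (simp add: field_simps power2_eq_square)
  show "w = 1" if "w + 1 / w = 2"
  proof -
    have "(w - 1) ^ 2 = w ^ 2 + 1 - w * 2" by (simp add: power2_eq_square algebra_simps)
    then have "(w - 1) ^ 2 = 0" using eq[symmetric] unfolding that by simp
    then show ?thesis by simp
  qed
  show "w = -1" if "w + 1 / w = -2"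
  proof -
    have "(w + 1) ^ 2 = w ^ 2 + 1 - w * (-2)" by (simp add: power2_eq_square algebra_simps)
    then have "(w + 1) ^ 2 = 0" using eq[symmetric] unfolding that by simp
    then show ?thesis by (simp add: eq_neg_iff_add_eq_0)
  qed
  show "w ^ 2 = -1" if "w + 1 / w = 0"
    using eq unfolding that by (simp add: eq_neg_iff_add_eq_0)
  show "w ^ 3 = -1" if "w + 1 / w = 1"
  proof -
    have sq: "w ^ 2 = w - 1" using eq[symmetric] unfolding that by (simp add: eq_diff_eq)
    have "w ^ 3 = w * w ^ 2" by (simp add: power2_eq_square power3_eq_cube)
    also have "\<dots> = w * (w - 1)" by (simp only: sq)
    also have "\<dots> = w ^ 2 - w" by (simp add: power2_eq_square algebra_simps)
    also have "\<dots> = -1" by (simp add: sq)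
    finally show ?thesis .
  qed
  show "w ^ 3 = 1" if "w + 1 / w = -1"
  proof -
    have sq: "w ^ 2 = - w - 1" using eq[symmetric] unfolding that by (simp add: eq_diff_eq)
    have "w ^ 3 = w * w ^ 2" by (simp add: power2_eq_square power3_eq_cube)
    also have "\<dots> = w * (- w - 1)" by (simp only: sq)
    also have "\<dots> = - (w ^ 2) - w" by (simp add: power2_eq_square algebra_simps)
    also have "\<dots> = 1" by (simp add: sq)
    finally show ?thesis .
  qed
qed

text \<open>For trace 0 both sides vanish. Otherwise \<open>w\<close> or \<open>w ^ 3\<close> is 1
  or -1; as \<open>n\<close> is even and \<open>w ^ n\<close> equals its own cube,
  \<open>w ^ n = 1\<close>.\<close>

lemma trace_sign_even:
  fixes w :: complex
  assumes "even n" "n > 0" and w: "w ^ (2 * n) = 1" and tr: "w + 1 / w \<in> {-2, -1, 0, 1, 2}"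
  shows "(w + 1 / w) * w ^ n = w + 1 / w"
proof -
  have w0: "w \<noteq> 0" using assms by (auto simp: power_0_left)
  have sq: "(w ^ n) ^ 2 = 1" using w by (simp add: power_mult mult.commute)
  have cube: "(w ^ 3) ^ n = w ^ n"
  proof -
    have "(w ^ 3) ^ n = (w ^ n) ^ 2 * w ^ n"
      by (simp add: power2_eq_square power3_eq_cube power_mult_distrib)
    then show ?thesis using sq by simp
  qed
  show ?thesis
    using tr trace_cases[OF w0] cube \<open>even n\<close> by (auto simp: add_eq_0_iff)
qed

text \<open>Trace 0 is impossible, since w^2 = -1 and odd \<open>n\<close> give w^(2n) = -1. For the
  traces 2, -2, 1, -1 the sign \<open>w ^ n\<close> is 1, -1, -1, 1, which fits in each
  case.\<close>

lemma trace_sign_odd: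
  fixes w :: complex
  assumes "odd n" and w: "w ^ (2 * n) = 1" and tr: "w + 1 / w \<in> {-2, -1, 0, 1, 2}"
  shows "(w + 1 / w) ^ 2 = (w + 1 / w) * w ^ n + 2"
proof -
  have n: "n > 0" using assms by (auto intro: Nat.gr0I)
  then have w0: "w \<noteq> 0" using assms by (auto simp: power_0_left)
  have sq: "(w ^ n) ^ 2 = 1" using w by (simp add: power_mult mult.commute)
  have cube: "(w ^ 3) ^ n = w ^ n"
  proof -
    have "(w ^ 3) ^ n = (w ^ n) ^ 2 * w ^ n"
      by (simp add: power2_eq_square power3_eq_cube power_mult_distrib)
    then show ?thesis using sq by simp
  qed
  have "w + 1 / w \<noteq> 0"
  proof
    assume "w + 1 / w = 0"
    then have "w ^ 2 = -1" by (rule trace_cases[OF w0])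
    then have "(w ^ 2) ^ n = -1" using \<open>odd n\<close> by simp
    then show False using w by (simp add: power_mult)
  qed
  then consider "w + 1 / w = 2" | "w + 1 / w = -2" | "w + 1 / w = 1" | "w + 1 / w = -1"
    using tr by auto
  then show ?thesis
  proof cases
    case 1
    then show ?thesis using trace_cases(1)[OF w0] by simp
  next
    case 2
    then show ?thesis using trace_cases(2)[OF w0] \<open>odd n\<close> by simp
  next
    case 3
    then have "w ^ n = -1" using trace_cases(4)[OF w0] cube \<open>odd n\<close> by simp
    then show ?thesis unfolding 3 by simp
  next
    case 4
    then have "w ^ n = 1" using trace_cases(5)[OF w0] cube by simp
    then show ?thesis unfolding 4 by simp
  qed
qed

section \<open>Spectral consequences of involutive transfer\<close>

lemma sum_Suc_periodic:
  fixes g :: "nat \<Rightarrow> 'b :: ab_group_add"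
  assumes "g n = g 0"
  shows "(\<Sum>t<n. g (Suc t)) = (\<Sum>t<n. g t)"
  using sum.lessThan_Suc_shift[of g n] sum.lessThan_Suc[of g n] assms by simp

lemma grover_power_zero: "(grover E ^^ t) (\<lambda>a. 0) = (\<lambda>a. 0)"
  by (induction t) (auto simp: grover_def)

lemma grover_add: "grover E (\<lambda>a. \<psi> a + \<phi> a) = (\<lambda>a. grover E \<psi> a + grover E \<phi> a)"
  by (auto simp: grover_def sum.distrib algebra_simps)

lemma grover_power_add:
  "(grover E ^^ t) (\<lambda>a. \<psi> a + \<phi> a) = (\<lambda>a. (grover E ^^ t) \<psi> a + (grover E ^^ t) \<phi> a)"
  by (induction t) (simp_all add: grover_add)

lemma grover_power_sum:
  assumes "finite I"
  shows "(grover E ^^ t) (\<lambda>a. \<Sum>i\<in>I. c i * \<psi> i a) = (\<lambda>a. \<Sum>i\<in>I. c i * (grover E ^^ t) (\<psi> i) a)"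
  using assms by induction (simp_all add: grover_power_zero grover_power_add grover_power_mult)

text \<open>The input of the spectral argument, free of distances: regularity, and transfer with
  phase 1 from every vertex to its image under an involution.\<close>

locale involutive_transfer = pair_graph G for G :: "'a pair_pre_digraph" +
  fixes k \<tau> :: nat and \<sigma> :: "'a \<Rightarrow> 'a"
  assumes degree: "x \<in> pverts G \<Longrightarrow> card (parcs G `` {x}) = k"
    and k_pos: "k > 0"
    and \<tau>_pos: "\<tau> > 0"
    and \<sigma>_in: "x \<in> pverts G \<Longrightarrow> \<sigma> x \<in> pverts G"
    and \<sigma>_\<sigma>: "x \<in> pverts G \<Longrightarrow> \<sigma> (\<sigma> x) = x"
    and transfer: "x \<in> pverts G \<Longrightarrow> a \<in> parcs G \<Longrightarrow> (grover (parcs G) ^^ \<tau>) (into x) a = into (\<sigma> x) a"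
begin

abbreviation V :: "'a set" where "V \<equiv> pverts G"

definition adj :: "('a \<Rightarrow> complex) \<Rightarrow> 'a \<Rightarrow> complex" where
  "adj f x = (\<Sum>y\<in>nbrs x. f y)"

lemma adj_cong: "(\<And>y. y \<in> V \<Longrightarrow> f y = g y) \<Longrightarrow> adj f x = adj g x"
  unfolding adj_def using nbrs_subset by (intro sum.cong) auto

lemma adj_mult: "adj (\<lambda>y. c * f y) x = c * adj f x"
  by (simp add: adj_def sum_distrib_left)

lemma adj_sum: "adj (\<lambda>y. \<Sum>i\<in>I. f i y) x = (\<Sum>i\<in>I. adj (f i) x)"
  unfolding adj_def by (rule sum.swap)

lemma adj_power_cong: "(\<And>y. y \<in> V \<Longrightarrow> f y = g y) \<Longrightarrow> x \<in> V \<Longrightarrow> (adj ^^ n) f x = (adj ^^ n) g x"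
  by (induction n arbitrary: x) (auto intro!: adj_cong)

lemma grover_power_cong:
  assumes "\<And>a. a \<in> parcs G \<Longrightarrow> \<psi> a = \<phi> a" "a \<in> parcs G"
  shows "(grover (parcs G) ^^ t) \<psi> a = (grover (parcs G) ^^ t) \<phi> a"
  using assms(2)
proof (induction t arbitrary: a)
  case 0
  then show ?case using assms(1) by simp
next
  case (Suc t)
  obtain x y where a: "a = (x, y)" by fastforce
  have "(\<Sum>z\<in>nbrs x. (grover (parcs G) ^^ t) \<psi> (z, x)) = (\<Sum>z\<in>nbrs x. (grover (parcs G) ^^ t) \<phi> (z, x))"
    by (intro sum.cong refl Suc.IH) (auto intro: arcs_symmetric)
  moreover have "(grover (parcs G) ^^ t) \<psi> (y, x) = (grover (parcs G) ^^ t) \<phi> (y, x)"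
    using Suc.prems a by (intro Suc.IH) (auto intro: arcs_symmetric)
  ultimately show ?case by (simp add: a grover_apply)
qed

definition lift :: "('a \<Rightarrow> complex) \<Rightarrow> 'a \<times> 'a \<Rightarrow> complex" where
  "lift f a = f (snd a)"

text \<open>On a \<open>k\<close>-regular graph this is N U^t N* applied to \<open>f\<close>, with
  the two factors 1 / sqrt k merged.\<close>

definition mean :: "('a \<Rightarrow> complex) \<Rightarrow> nat \<Rightarrow> 'a \<Rightarrow> complex" where
  "mean f t x = (\<Sum>z\<in>nbrs x. (grover (parcs G) ^^ t) (lift f) (z, x)) / of_nat k"

lemma grover_power_Suc:
  assumes "x \<in> V"
  shows "(grover (parcs G) ^^ Suc t) (lift f) (x, y) = 2 * mean f t x - (grover (parcs G) ^^ t) (lift f) (y, x)"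
  using degree[OF assms] by (simp add: grover_apply mean_def)

lemma mean_lift:
  assumes "x \<in> V" "\<And>a. a \<in> parcs G \<Longrightarrow> (grover (parcs G) ^^ t) (lift f) a = lift g a"
  shows "mean f t x = g x"
proof -
  have "(\<Sum>z\<in>nbrs x. (grover (parcs G) ^^ t) (lift f) (z, x)) = (\<Sum>z\<in>nbrs x. g x)"
  proof (intro sum.cong refl)
    fix z assume "z \<in> nbrs x"
    then have "(z, x) \<in> parcs G" by (auto intro: arcs_symmetric)
    then show "(grover (parcs G) ^^ t) (lift f) (z, x) = g x" by (simp add: assms(2) lift_def)
  qed
  then show ?thesis
    using degree[OF assms(1)] k_pos by (simp add: mean_def)
qed

lemma mean_0: "x \<in> V \<Longrightarrow> mean f 0 x = f x"
  by (rule mean_lift) simp_all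

text \<open>The one-step rule is used twice, first at the neighbour \<open>z\<close> and then at
  \<open>x\<close>; the two reversals return to the arc \<open>(z, x)\<close> at time
  \<open>t\<close>. This is the Chebyshev recurrence in A/k.\<close>

lemma mean_recurrence:
  assumes x: "x \<in> V"
  shows "mean f (Suc (Suc t)) x + mean f t x = 2 / of_nat k * adj (mean f (Suc t)) x"
proof -
  let ?U = "\<lambda>t. (grover (parcs G) ^^ t) (lift f)"
  have "(\<Sum>z\<in>nbrs x. ?U (Suc (Suc t)) (z, x)) = (\<Sum>z\<in>nbrs x. 2 * mean f (Suc t) z - ?U (Suc t) (x, z))"
    using nbrs_subset by (intro sum.cong refl grover_power_Suc) auto
  also have "\<dots> = 2 * adj (mean f (Suc t)) x - (\<Sum>z\<in>nbrs x. ?U (Suc t) (x, z))"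
    by (simp add: sum_subtractf adj_def sum_distrib_left)
  also have "(\<Sum>z\<in>nbrs x. ?U (Suc t) (x, z)) = (\<Sum>z\<in>nbrs x. 2 * mean f t x - ?U t (z, x))"
    by (intro sum.cong refl grover_power_Suc x)
  also have "\<dots> = of_nat k * mean f t x"
    using degree[OF x] k_pos by (simp add: sum_subtractf mean_def)
  finally show ?thesis
    using k_pos unfolding mean_def[of f "Suc (Suc t)"] by (simp add: field_simps)
qed

text \<open>On arcs \<open>lift f\<close> is the combination of the \<open>into x\<close> with
  coefficients \<open>f x\<close>, so linearity reduces to the transfer of each. As \<sigma> is an
  involution, only \<open>x = \<sigma> (snd a)\<close> contributes at \<open>a\<close>.\<close>

lemma grover_power_lift:
  assumes a: "a \<in> parcs G"
  shows "(grover (parcs G) ^^ \<tau>) (lift f) a = lift (\<lambda>x. f (\<sigma> x)) a"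
proof -
  have s: "snd a \<in> V" using a by (rule arc_snd_in_verts)
  have "(grover (parcs G) ^^ \<tau>) (lift f) a = (grover (parcs G) ^^ \<tau>) (\<lambda>a. \<Sum>x\<in>V. f x * into x a) a"
  proof (rule grover_power_cong[OF _ a])
    fix a assume "a \<in> parcs G"
    then have "snd a \<in> V" by (rule arc_snd_in_verts)
    have "(\<Sum>x\<in>V. f x * into x a) = (\<Sum>x\<in>V. if x = snd a then f x else 0)"
      by (intro sum.cong) (auto simp: into_def)
    then show "lift f a = (\<Sum>x\<in>V. f x * into x a)"
      using \<open>snd a \<in> V\<close> pair_finite_verts by (simp add: lift_def)
  qed
  also have "\<dots> = (\<Sum>x\<in>V. f x * into (\<sigma> x) a)"
    using transfer a by (simp add: grover_power_sum[OF pair_finite_verts])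
  also have "\<dots> = (\<Sum>x\<in>V. if x = \<sigma> (snd a) then f x else 0)"
    using s \<sigma>_\<sigma> by (intro sum.cong) (auto simp: into_def)
  also have "\<dots> = lift (\<lambda>x. f (\<sigma> x)) a"
    using s \<sigma>_in pair_finite_verts by (simp add: lift_def)
  finally show ?thesis .
qed

lemma mean_transfer: "x \<in> V \<Longrightarrow> mean f \<tau> x = f (\<sigma> x)"
  by (rule mean_lift) (simp_all add: grover_power_lift)

lemma mean_period:
  assumes x: "x \<in> V"
  shows "mean f (t + 2 * \<tau>) x = mean f t x"
proof -
  have "(grover (parcs G) ^^ (2 * \<tau>)) (lift f) a = lift f a" if a: "a \<in> parcs G" for a
  proof -
    have "(grover (parcs G) ^^ (2 * \<tau>)) (lift f) a
        = (grover (parcs G) ^^ \<tau>) ((grover (parcs G) ^^ \<tau>) (lift f)) a"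
      by (simp add: mult_2 funpow_add)
    also have "\<dots> = (grover (parcs G) ^^ \<tau>) (lift (\<lambda>x. f (\<sigma> x))) a"
      using a by (intro grover_power_cong grover_power_lift)
    also have "\<dots> = lift f a"
      using a arc_snd_in_verts[OF a] by (simp add: grover_power_lift lift_def \<sigma>_\<sigma>)
    finally show ?thesis .
  qed
  then have "(grover (parcs G) ^^ (t + 2 * \<tau>)) (lift f) a = (grover (parcs G) ^^ t) (lift f) a"
    if "a \<in> parcs G" for a
    using that unfolding funpow_add comp_def by (intro grover_power_cong)
  then have "(\<Sum>z\<in>nbrs x. (grover (parcs G) ^^ (t + 2 * \<tau>)) (lift f) (z, x)) =
      (\<Sum>z\<in>nbrs x. (grover (parcs G) ^^ t) (lift f) (z, x))"
    by (intro sum.cong refl) (auto intro: arcs_symmetric)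
  then show ?thesis by (simp only: mean_def)
qed

text \<open>The sequence \<open>t \<mapsto> mean f t\<close> is \<open>2 \<tau>\<close>-periodic and satisfies a three-term recurrence, so its
  discrete Fourier coefficients are eigenvectors of the adjacency operator.\<close>

definition component :: "complex \<Rightarrow> ('a \<Rightarrow> complex) \<Rightarrow> 'a \<Rightarrow> complex" where
  "component w f x = (\<Sum>t<2 * \<tau>. w ^ t * mean f t x) / of_nat (2 * \<tau>)"

definition freqs :: "complex set" where
  "freqs = {w. w ^ (2 * \<tau>) = 1}"

lemma freqs_nonzero: "w \<in> freqs \<Longrightarrow> w \<noteq> 0"
  using \<tau>_pos by (auto simp: freqs_def power_0_left)

text \<open>Periodicity lets the sum start at time 1. There the recurrence expresses the adjacency
  operator through the times \<open>t\<close> and \<open>t + 2\<close>, and shifting back costs a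
  factor \<open>w\<close> or \<open>1 / w\<close>.\<close>

lemma adj_component:
  assumes w: "w \<in> freqs" and x: "x \<in> V"
  shows "adj (component w f) x = of_nat k * (w + 1 / w) / 2 * component w f x"
proof -
  let ?n = "2 * \<tau>" and ?g = "\<lambda>t x. w ^ t * mean f t x"
  have w0: "w \<noteq> 0" and wn: "w ^ ?n = 1" using w freqs_nonzero by (auto simp: freqs_def)
  define S where "S = (\<lambda>x. \<Sum>t<?n. ?g t x)"
  have per: "?g (t + ?n) x = ?g t x" if "x \<in> V" for t x
    using mean_period[OF that] wn by (simp add: power_add)
  have shift1: "(\<Sum>t<?n. ?g (Suc t) x) = S x" if "x \<in> V" for x
    unfolding S_def using per[OF that, of 0] by (intro sum_Suc_periodic) simp
  have shift2: "(\<Sum>t<?n. ?g (Suc (Suc t)) x) = S x"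
  proof -
    have "(\<Sum>t<?n. ?g (Suc (Suc t)) x) = (\<Sum>t<?n. ?g (Suc t) x)"
      using per[OF x, of 1] by (intro sum_Suc_periodic[of "\<lambda>t. ?g (Suc t) x"]) (simp only: add_Suc add_0 One_nat_def)
    then show ?thesis using shift1[OF x] by simp
  qed
  have "adj S x = adj (\<lambda>x. \<Sum>t<?n. ?g (Suc t) x) x"
    by (intro adj_cong) (simp only: shift1)
  also have "\<dots> = (\<Sum>t<?n. w ^ Suc t * adj (mean f (Suc t)) x)"
    by (simp only: adj_sum adj_mult)
  also have "\<dots> = (\<Sum>t<?n. of_nat k / 2 * (1 / w * ?g (Suc (Suc t)) x + w * ?g t x))"
  proof (intro sum.cong refl)
    fix t
    have "adj (mean f (Suc t)) x = of_nat k / 2 * (mean f (Suc (Suc t)) x + mean f t x)"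
      unfolding mean_recurrence[OF x] using k_pos by simp
    moreover have "w ^ Suc t * (c * (p + q)) = c * (1 / w * (w ^ Suc (Suc t) * p) + w * (w ^ t * q))" for c p q
      using w0 by (simp add: field_simps)
    ultimately show "w ^ Suc t * adj (mean f (Suc t)) x = of_nat k / 2 * (1 / w * ?g (Suc (Suc t)) x + w * ?g t x)"
      by (simp only:)
  qed
  also have "\<dots> = of_nat k / 2 * (1 / w * S x + w * S x)"
    by (simp only: sum.distrib flip: sum_distrib_left) (simp only: shift2 S_def)
  finally have "adj S x = of_nat k * (w + 1 / w) / 2 * S x"
    by (simp add: algebra_simps)
  moreover have "component w f = (\<lambda>x. 1 / of_nat ?n * S x)"
    by (simp add: fun_eq_iff component_def S_def)
  ultimately show ?thesis by (simp only: adj_mult mult.left_commute)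
qed

text \<open>Fourier inversion: summing \<open>w ^ (s + t)\<close> over all frequencies retains only
  \<open>t = -s\<close> modulo \<open>2 * \<tau>\<close>, and the \<open>mod\<close> covers
  \<open>s = 0\<close>. The cases \<open>s = 0\<close> and \<open>s = \<tau>\<close> recover
  \<open>f\<close> and its composition with \<sigma>.\<close>

lemma sum_freqs_component:
  assumes "x \<in> V" "s < 2 * \<tau>"
  shows "(\<Sum>w\<in>freqs. w ^ s * component w f x) = mean f ((2 * \<tau> - s) mod (2 * \<tau>)) x"
proof -
  let ?n = "2 * \<tau>"
  have n: "?n > 0" using \<tau>_pos by simp
  have "(\<Sum>w\<in>freqs. w ^ s * component w f x)
      = (\<Sum>w\<in>freqs. \<Sum>t<?n. w ^ (s + t) * (mean f t x / of_nat ?n))"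
    by (simp add: component_def sum_distrib_left sum_divide_distrib power_add mult.assoc)
  also have "\<dots> = (\<Sum>t<?n. (\<Sum>w\<in>freqs. w ^ (s + t)) * (mean f t x / of_nat ?n))"
    by (subst sum.swap) (simp only: sum_distrib_right)
  also have "\<dots> = (\<Sum>t<?n. if t = (?n - s) mod ?n then mean f t x else 0)"
  proof (intro sum.cong refl)
    fix t assume t: "t \<in> {..<?n}"
    have "?n dvd s + t \<longleftrightarrow> t = (?n - s) mod ?n"
    proof
      assume "?n dvd s + t"
      then obtain q where q: "s + t = ?n * q" by blast
      have "q < 2" using q t assms(2) by (metis add_less_mono lessThan_iff mult_2_right mult_less_cancel1 nat_mult_less_cancel1 n)
      then consider "q = 0" | "q = 1" by linarith
      then show "t = (?n - s) mod ?n"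
        using q t by cases auto
    next
      assume "t = (?n - s) mod ?n"
      then have "(s + t) mod ?n = (s + (?n - s)) mod ?n" by (simp add: mod_add_right_eq)
      then show "?n dvd s + t" using assms(2) by (simp add: dvd_eq_mod_eq_0)
    qed
    then show "(\<Sum>w\<in>freqs. w ^ (s + t)) * (mean f t x / of_nat ?n) =
        (if t = (?n - s) mod ?n then mean f t x else 0)"
      unfolding freqs_def using \<tau>_pos by (simp add: sum_roots_unity_power)
  qed
  also have "\<dots> = mean f ((?n - s) mod ?n) x" using n by simp
  finally show ?thesis .
qed

lemma sum_component: "x \<in> V \<Longrightarrow> (\<Sum>w\<in>freqs. component w f x) = f x"
  using sum_freqs_component[of x 0 f] \<tau>_pos mean_0 by simp

lemma sum_component_\<sigma>: "x \<in> V \<Longrightarrow> (\<Sum>w\<in>freqs. w ^ \<tau> * component w f x) = f (\<sigma> x)"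
  using sum_freqs_component[of x \<tau> f] \<tau>_pos mean_transfer by simp

lemma adj_power_component:
  assumes "w \<in> freqs" "x \<in> V"
  shows "(adj ^^ n) (component w f) x = (of_nat k * (w + 1 / w) / 2) ^ n * component w f x"
  using assms(2)
proof (induction n arbitrary: x)
  case (Suc n)
  have "(adj ^^ Suc n) (component w f) x = adj (\<lambda>x. (of_nat k * (w + 1 / w) / 2) ^ n * component w f x) x"
    unfolding funpow.simps comp_def by (intro adj_cong Suc.IH)
  then show ?case using assms(1) Suc.prems by (simp add: adj_mult adj_component)
qed simp

lemma adj_power_sum_mult:
  "(adj ^^ n) (\<lambda>y. \<Sum>i\<in>I. c i * f i y) x = (\<Sum>i\<in>I. c i * (adj ^^ n) (f i) x)"
proof (induction n arbitrary: x)
  case (Suc n)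
  have "(adj ^^ n) (\<lambda>y. \<Sum>i\<in>I. c i * f i y) = (\<lambda>x. \<Sum>i\<in>I. c i * (adj ^^ n) (f i) x)"
    by (rule ext) (rule Suc.IH)
  then show ?case by (simp add: adj_sum adj_mult)
qed simp

lemma adj_power_eq:
  assumes "x \<in> V"
  shows "(adj ^^ n) f x = (\<Sum>w\<in>freqs. (of_nat k * (w + 1 / w) / 2) ^ n * component w f x)"
proof -
  have "(adj ^^ n) f x = (adj ^^ n) (\<lambda>y. \<Sum>w\<in>freqs. 1 * component w f y) x"
    using assms by (intro adj_power_cong) (simp add: sum_component)
  then show ?thesis
    using assms unfolding adj_power_sum_mult by (simp add: adj_power_component)
qed

lemma adj_\<sigma>_eq:
  assumes "x \<in> V"
  shows "adj (\<lambda>y. f (\<sigma> y)) x = (\<Sum>w\<in>freqs. of_nat k * (w + 1 / w) / 2 * w ^ \<tau> * component w f x)"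
proof -
  have "adj (\<lambda>y. f (\<sigma> y)) x = adj (\<lambda>y. \<Sum>w\<in>freqs. w ^ \<tau> * component w f y) x"
    by (intro adj_cong) (simp add: sum_component_\<sigma>)
  also have "\<dots> = (\<Sum>w\<in>freqs. w ^ \<tau> * (of_nat k * (w + 1 / w) / 2 * component w f x))"
    using assms by (simp add: adj_sum adj_mult adj_component)
  finally show ?thesis by (simp add: mult_ac)
qed

end

section \<open>Consequences of integrality\<close>

locale integral_involutive_transfer = involutive_transfer +
  assumes integral: "integral_graph G"
begin

text \<open>A nonzero component is an eigenvector, so \<open>of_nat k * (w + 1 / w) / 2\<close> is
  an integer by integrality; the trace is then rational and Niven's theorem applies.\<close>

lemma trace_component:
  assumes w: "w \<in> freqs" and x: "x \<in> V" "component w f x \<noteq> 0"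
  shows "w + 1 / w \<in> {-2, -1, 0, 1, 2}"
proof -
  have "of_nat k * (w + 1 / w) / 2 \<in> \<int>"
    using adj_component[OF w] by (intro integral_graph_eigenvalue[where f="component w f", OF integral x]) (simp add: adj_def)
  then obtain i where "of_nat k * (w + 1 / w) / 2 = of_int i" by (auto elim: Ints_cases)
  then have "w + 1 / w = 2 * of_int i / of_nat k"
    using k_pos by (simp add: field_simps)
  also have "\<dots> \<in> \<rat>" by simp
  finally show ?thesis
    using w \<tau>_pos by (intro Niven_theorem[of "2 * \<tau>"]) (auto simp: freqs_def)
qed

lemma adj_\<sigma>_even:
  assumes "even \<tau>" and x: "x \<in> V"
  shows "adj (\<lambda>y. f (\<sigma> y)) x = adj f x"
proof -
  have "of_nat k * (w + 1 / w) / 2 * w ^ \<tau> * component w f x = of_nat k * (w + 1 / w) / 2 * component w f x"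
    if w: "w \<in> freqs" for w
  \<comment> \<open>The trace is restricted only where the component is nonzero; elsewhere both
    sides vanish.\<close>
  proof (cases "component w f x = 0")
    case False
    have "(w + 1 / w) * w ^ \<tau> = w + 1 / w"
      using w assms(1) \<tau>_pos trace_component[OF w x False]
      by (intro trace_sign_even) (auto simp: freqs_def)
    then show ?thesis by (metis mult.assoc times_divide_eq_left)
  qed simp
  then have "adj (\<lambda>y. f (\<sigma> y)) x = (\<Sum>w\<in>freqs. of_nat k * (w + 1 / w) / 2 * component w f x)"
    unfolding adj_\<sigma>_eq[OF x] by (rule sum.cong[OF refl])
  also have "\<dots> = adj f x"
    using adj_power_eq[OF x, of 1 f] by simp
  finally show ?thesis .
qed

text \<open>On each component this is \<open>trace_sign_odd\<close> scaled by k^2/4.\<close>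

lemma adj_adj_odd:
  assumes "odd \<tau>" and x: "x \<in> V"
  shows "adj (adj f) x = of_nat k / 2 * adj (\<lambda>y. f (\<sigma> y)) x + of_nat k ^ 2 / 2 * f x"
proof -
  have "(of_nat k * (w + 1 / w) / 2) ^ 2 * component w f x =
      of_nat k / 2 * (of_nat k * (w + 1 / w) / 2 * w ^ \<tau> * component w f x) + of_nat k ^ 2 / 2 * component w f x"
    if w: "w \<in> freqs" for w
  proof (cases "component w f x = 0")
    case False
    have "(w + 1 / w) ^ 2 = (w + 1 / w) * w ^ \<tau> + 2"
      using w assms(1) trace_component[OF w x False]
      by (intro trace_sign_odd) (auto simp: freqs_def)
    then have "(of_nat k * (w + 1 / w) / 2) ^ 2 = of_nat k ^ 2 * ((w + 1 / w) * w ^ \<tau> + 2) / 4"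
      by (simp add: power_mult_distrib power_divide)
    moreover have "K ^ 2 * (s * e + 2) / 4 * c = K / 2 * (K * s / 2 * e * c) + K ^ 2 / 2 * c" for K s e c :: complex
      by (simp add: power2_eq_square field_simps)
    ultimately show ?thesis by (simp only:)
  qed simp
  then have "(\<Sum>w\<in>freqs. (of_nat k * (w + 1 / w) / 2) ^ 2 * component w f x) =
    (\<Sum>w\<in>freqs. of_nat k / 2 * (of_nat k * (w + 1 / w) / 2 * w ^ \<tau> * component w f x)
      + of_nat k ^ 2 / 2 * component w f x)"
    by (rule sum.cong[OF refl])
  also have "\<dots> = of_nat k / 2 * adj (\<lambda>y. f (\<sigma> y)) x + of_nat k ^ 2 / 2 * (\<Sum>w\<in>freqs. component w f x)"
    by (simp only: adj_\<sigma>_eq[OF x] sum.distrib sum_distrib_left)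
  finally show ?thesis
    using adj_power_eq[OF x, of 2 f] by (simp add: sum_component[OF x] numeral_2_eq_2)
qed

text \<open>An arbitrary eigenvector need not be a Fourier component, so \<theta> is tested against
  a polynomial that vanishes at the eigenvalues of all contributing components.\<close>

lemma eigenvalue_cases:
  assumes x: "x \<in> V" "f x \<noteq> 0" and eig: "\<And>y. y \<in> V \<Longrightarrow> adj f y = \<theta> * f y"
  shows "2 * \<theta> / of_nat k \<in> {-2, -1, 0, 1, 2}"
proof -
  let ?\<mu> = "\<lambda>w. of_nat k * (w + 1 / w) / 2" and ?k = "of_nat k :: complex"
  have pow: "(adj ^^ n) f y = \<theta> ^ n * f y" if "y \<in> V" for n y
    using that
  proof (induction n arbitrary: y)
    case (Suc n)
    have "adj ((adj ^^ n) f) y = adj (\<lambda>y. \<theta> ^ n * f y) y"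
      by (intro adj_cong) (rule Suc.IH)
    then show ?case using eig[OF Suc.prems] by (simp add: adj_mult)
  qed simp
  \<comment> \<open>The roots of \<open>?p\<close> are \<open>0\<close>, \<open>\<plusminus> k / 2\<close> and \<open>\<plusminus> k\<close>, so \<open>?p\<close> annihilates the adjacency operator.\<close>
  let ?p = "\<lambda>z. 4 * z ^ 5 - 5 * ?k ^ 2 * z ^ 3 + ?k ^ 4 * z :: complex"
  \<comment> \<open>The polynomial is 4z(z^2 - k^2/4)(z^2 - k^2); the substitution
    \<open>z = ?k * s / 2\<close> expresses it through the trace \<open>s\<close>.\<close>
  have p_scaled: "?p (?k * s / 2) = ?k ^ 5 * (s * (s ^ 2 - 1) * (s ^ 2 - 4)) / 8" for s
    by (simp add: power_mult_distrib power_divide eval_nat_numeral field_simps)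
  have "?p \<theta> * f x = (\<Sum>w\<in>freqs. ?p (?\<mu> w) * component w f x)"
  proof -
    have "?p \<theta> * f x = 4 * (adj ^^ 5) f x - 5 * ?k ^ 2 * (adj ^^ 3) f x + ?k ^ 4 * (adj ^^ 1) f x"
      using x(1) by (simp only: pow) (simp add: algebra_simps)
    also have "\<dots> = (\<Sum>w\<in>freqs. 4 * (?\<mu> w ^ 5 * component w f x) - 5 * ?k ^ 2 * (?\<mu> w ^ 3 * component w f x)
        + ?k ^ 4 * (?\<mu> w ^ 1 * component w f x))"
      using x(1) by (simp only: adj_power_eq sum.distrib sum_subtractf sum_distrib_left)
    finally show ?thesis by (simp add: algebra_simps)
  qed
  also have "\<dots> = 0"
  proof (intro sum.neutral ballI)
    fix w assume w: "w \<in> freqs"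
    show "?p (?\<mu> w) * component w f x = 0"
    proof (cases "component w f x = 0")
      case False
      have "s * (s ^ 2 - 1) * (s ^ 2 - 4) = 0" if "s \<in> {-2, -1, 0, 1, 2}" for s :: complex
        using that by auto
      note this[OF trace_component[OF w x(1) False]]
      then have "?p (?\<mu> w) = ?k ^ 5 * 0 / 8" by (simp only: p_scaled)
      then show ?thesis by simp
    qed simp
  qed
  finally have p: "?p \<theta> = 0" using x(2) by simp
  define s where "s = 2 * \<theta> / ?k"
  have "\<theta> = ?k * s / 2" using k_pos by (simp add: s_def)
  then have "?k ^ 5 * (s * (s ^ 2 - 1) * (s ^ 2 - 4)) / 8 = 0"
    using p p_scaled[of s] by (simp only:)
  then have "s = 0 \<or> s ^ 2 = 1 ^ 2 \<or> s ^ 2 = 2 ^ 2" using k_pos by simp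
  then have "s \<in> {-2, -1, 0, 1, 2}" by (auto simp only: power2_eq_iff insert_iff)
  then show ?thesis by (simp add: s_def)
qed

end

section \<open>State transfer in the four graphs\<close>

lemma graph_isoI:
  assumes "pair_wf_digraph G" and bij: "bij_betw h (pverts G) (pverts H)"
    and arcs: "\<And>x y. x \<in> pverts G \<Longrightarrow> y \<in> pverts G \<Longrightarrow> (x, y) \<in> parcs G \<longleftrightarrow> (h x, h y) \<in> parcs H"
    and H: "parcs H \<subseteq> pverts H \<times> pverts H"
  shows "graph_iso G H"
proof -
  interpret pair_wf_digraph G by fact
  let ?f = "\<lparr> iso_verts = h, iso_arcs = map_prod h h, iso_head = snd, iso_tail = fst \<rparr>"
  have inj: "inj_on h (pverts G)" and img: "h ` pverts G = pverts H"
    using bij by (auto simp: bij_betw_def)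
  have sub: "parcs G \<subseteq> pverts G \<times> pverts G"
    by (auto dest: in_arcsD1 in_arcsD2)
  have "inj_on (map_prod h h) (parcs G)"
    using map_prod_inj_on[OF inj inj] sub by (rule inj_on_subset)
  then have "digraph_isomorphism ?f"
    unfolding digraph_isomorphism_def using inj wf_digraph_wp_iff assms(1) by auto
  moreover have "map_prod h h ` parcs G = parcs H"
  proof (rule Set.set_eqI)
    fix e
    show "e \<in> map_prod h h ` parcs G \<longleftrightarrow> e \<in> parcs H"
    proof
      assume "e \<in> map_prod h h ` parcs G"
      then show "e \<in> parcs H" using arcs by (auto dest: in_arcsD1 in_arcsD2)
    next
      assume e: "e \<in> parcs H"
      then obtain x y where "x \<in> pverts G" "y \<in> pverts G" "e = (h x, h y)"
        using H img by (cases e) blast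
      then show "e \<in> map_prod h h ` parcs G"
        using arcs e by force
    qed
  qed
  then have "with_proj H = app_iso ?f (with_proj G)"
    by (simp add: app_iso_def with_proj_def img)
  ultimately show ?thesis
    unfolding graph_iso_def digraph_iso_def by blast
qed

text \<open>Head and tail are the projections of pairs in both graphs, which forces the arc map of
  an isomorphism to act by its vertex map on both ends.\<close>

lemma graph_isoE:
  assumes "graph_iso G H" "pair_wf_digraph G"
  obtains h where "bij_betw h (pverts G) (pverts H)"
    "\<And>x y. x \<in> pverts G \<Longrightarrow> y \<in> pverts G \<Longrightarrow> (x, y) \<in> parcs G \<longleftrightarrow> (h x, h y) \<in> parcs H"
proof -
  interpret pair_wf_digraph G by fact
  obtain f where f: "digraph_isomorphism f" and H: "with_proj H = app_iso f (with_proj G)"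
    using assms(1) unfolding graph_iso_def digraph_iso_def by blast
  let ?h = "iso_verts f"
  have inj: "inj_on ?h (pverts G)"
    using f by (simp add: digraph_isomorphism_def)
  have sel: "pverts H = ?h ` pverts G" "parcs H = iso_arcs f ` parcs G" "fst = iso_tail f" "snd = iso_head f"
    using H by (simp_all add: app_iso_def with_proj_def)
  have arc: "iso_arcs f (x, y) = (?h x, ?h y)" if "(x, y) \<in> parcs G" for x y
  proof -
    have "?h x = iso_tail f (iso_arcs f (x, y))" "?h y = iso_head f (iso_arcs f (x, y))"
      using f that by (force simp: digraph_isomorphism_def)+
    then show ?thesis by (simp flip: sel(3,4))
  qed
  show ?thesis
  proof (rule that)
    show "bij_betw ?h (pverts G) (pverts H)"
      using inj sel(1) by (simp add: bij_betw_def)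
    fix x y assume xy: "x \<in> pverts G" "y \<in> pverts G"
    show "(x, y) \<in> parcs G \<longleftrightarrow> (?h x, ?h y) \<in> parcs H"
    proof
      assume "(?h x, ?h y) \<in> parcs H"
      then obtain x' y' where e: "(x', y') \<in> parcs G" "(?h x, ?h y) = iso_arcs f (x', y')"
        unfolding sel(2) by force
      then have "?h x = ?h x'" "?h y = ?h y'" using arc by auto
      then show "(x, y) \<in> parcs G"
        using e xy inj by (metis in_arcsD1 in_arcsD2 inj_on_eq_iff)
    qed (use arc sel(2) in force)
  qed
qed

context pair_graph
begin

text \<open>\<open>c\<close> is an equitable partition into cells \<open>0, \<dots>, n\<close> with quotient matrix \<open>b\<close>; the singleton
  cells \<open>0\<close> and \<open>m\<close> hold the source and the target of the transfer.\<close>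

lemma perfect_state_transfer_quotient:
  fixes ws :: "'b list" and c :: "'b \<Rightarrow> nat"
  assumes bij: "bij_betw h (pverts G) (set ws)" and ws: "distinct ws"
    and arcs: "\<And>x y. x \<in> pverts G \<Longrightarrow> y \<in> pverts G \<Longrightarrow> (x, y) \<in> parcs G \<longleftrightarrow> E (h x) (h y)"
    and cells: "\<forall>p\<in>set ws. \<forall>j\<in>{..n}. length (filter (\<lambda>q. E p q \<and> c q = j) ws) = b (c p) j"
    and bound: "\<forall>p\<in>set ws. c p \<le> n"
    and root: "\<forall>p\<in>set ws. c p = 0 \<longleftrightarrow> p = p0" "p0 \<in> set ws"
    and target: "\<forall>p\<in>set ws. c p = m \<longleftrightarrow> p = p1" "p1 \<in> set ws" "m > 0"
    and degree: "\<forall>p\<in>set ws. length (filter (E p) ws) = k" "k > 0"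
    and walk: "\<forall>i\<in>{..n}. \<forall>j\<in>{..n}. b i j > 0 \<longrightarrow>
      quotient_walk k n b \<tau> i j = (if j = m then 1 else 0)" "\<tau> > 0"
  shows "perfect_state_transfer G"
proof -
  let ?V = "pverts G"
  have inj: "inj_on h ?V" and img: "h ` ?V = set ws" using bij by (auto simp: bij_betw_def)
  have count: "card {z \<in> nbrs x. P (h z)} = length (filter (\<lambda>q. E (h x) q \<and> P q) ws)"
    if x: "x \<in> ?V" for x P
  proof -
    have "h ` {z \<in> nbrs x. P (h z)} = {q. E (h x) q \<and> P q} \<inter> set ws"
      unfolding img[symmetric] using x arcs by (auto dest: in_arcsD2)
    moreover have "inj_on h {z \<in> nbrs x. P (h z)}"
      using inj nbrs_subset by (auto intro: inj_on_subset)
    ultimately have "card {z \<in> nbrs x. P (h z)} = card ({q. E (h x) q \<and> P q} \<inter> set ws)"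
      by (metis card_image)
    then show ?thesis using distinct_length_filter[OF ws] by simp
  qed
  have hV: "h x \<in> set ws" if "x \<in> ?V" for x using that img by blast
  have reg: "card (nbrs x) = k" if "x \<in> ?V" for x
    using count[OF that, of "\<lambda>_. True"] degree(1) hV[OF that]
    unfolding simp_thms Collect_mem_eq by metis
  \<comment> \<open>The table \<open>b\<close> is constrained only up to \<open>n\<close>. Cells
    beyond \<open>n\<close> are empty, so counts there are set to 0; the quotient walk does not read
    these entries.\<close>
  define b' where "b' = (\<lambda>i j. if j \<le> n then b i j else 0)"
  have cells': "card {z \<in> nbrs x. c (h z) = j} = b' (c (h x)) j" if x: "x \<in> ?V" for x j
  proof (cases "j \<le> n")
    case True
    then show ?thesis
      using count[OF x, of "\<lambda>q. c q = j"] cells hV[OF x] by (simp add: b'_def)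
  next
    case False
    then have "{z \<in> nbrs x. c (h z) = j} = {}"
      using bound hV nbrs_subset[of x] by blast
    then show ?thesis using False by (simp only: b'_def) simp
  qed
  have b': "quotient_walk k n b' t i j = quotient_walk k n b t i j" for t i j
    by (induction t arbitrary: i j) (simp_all add: b'_def)
  obtain u v where u: "u \<in> ?V" "h u = p0" and v: "v \<in> ?V" "h v = p1"
    using root(2) target(2) img by (metis imageE)
  have "(grover (parcs G) ^^ \<tau>) (into u) a = 1 * into v a" if a: "a \<in> parcs G" for a
  proof -
    obtain x y where xy: "a = (x, y)" by fastforce
    have V: "x \<in> ?V" "y \<in> ?V" using a xy by (auto dest: in_arcsD1 in_arcsD2)
    have "(grover (parcs G) ^^ \<tau>) (into u) (x, y) = quotient_walk k n b' \<tau> (c (h x)) (c (h y))"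
    proof (rule grover_power_quotient[where c="\<lambda>x. c (h x)", OF cells' _ _ reg])
      fix z assume z: "z \<in> ?V"
      show "c (h z) \<le> n" using bound hV[OF z] by blast
      have "c (h z) = 0 \<longleftrightarrow> h z = h u" using root(1) hV[OF z] u by simp
      then show "c (h z) = 0 \<longleftrightarrow> z = u" using inj_on_eq_iff[OF inj z u(1)] by simp
    qed (use a xy in simp_all)
    also have "\<dots> = (if c (h y) = m then 1 else 0)"
    proof -
      \<comment> \<open>The arc itself shows that its two cells are joined, and \<open>walk\<close>
        speaks of such pairs of cells.\<close>
      have "y \<in> {z \<in> nbrs x. c (h z) = c (h y)}" using a xy by simp
      then have "card {z \<in> nbrs x. c (h z) = c (h y)} > 0"
        using finite_subset[of "{z \<in> nbrs x. c (h z) = c (h y)}" "nbrs x"]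
        by (auto simp: card_gt_0_iff)
      then have "b' (c (h x)) (c (h y)) > 0" by (simp only: cells'[OF V(1)])
      then have "b (c (h x)) (c (h y)) > 0" by (simp add: b'_def split: if_splits)
      then show ?thesis using walk(1) bound hV V by (simp add: b')
    qed
    also have "c (h y) = m \<longleftrightarrow> h y = h v" using target(1) hV[OF V(2)] v by simp
    also have "h y = h v \<longleftrightarrow> y = v" by (rule inj_on_eq_iff[OF inj V(2) v(1)])
    finally show ?thesis by (simp add: xy into_apply)
  qed
  moreover have "u \<noteq> v" using u v root target hV by force
  moreover have "cmod 1 = 1" by simp
  ultimately show ?thesis
    using perfect_state_transfer_regular_iff[OF reg degree(2)] u v walk(2) by blast
qed

section \<open>Explicit quotients for the four graphs\<close>

lemma perfect_state_transfer_K2: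
  assumes "graph_iso G (complete_graph 2)"
  shows "perfect_state_transfer G"
proof -
  obtain h where bij: "bij_betw h (pverts G) {..<2}"
    and arcs: "\<And>x y. x \<in> pverts G \<Longrightarrow> y \<in> pverts G \<Longrightarrow> (x, y) \<in> parcs G \<longleftrightarrow> (h x, h y) \<in> parcs (complete_graph 2)"
    using graph_isoE[OF assms] pair_wf_digraph by (auto simp: complete_graph_def)
  have ws: "{..<2} = set [0, 1 :: nat]" by auto
  have E: "(x, y) \<in> parcs G \<longleftrightarrow> h x \<noteq> h y" if "x \<in> pverts G" "y \<in> pverts G" for x y
    using arcs[OF that] bij that by (auto simp: complete_graph_def bij_betw_def)
  show ?thesis
    using bij unfolding ws
    by (rule perfect_state_transfer_quotient[where E="(\<noteq>)" and n=1 and c="\<lambda>i. i" and m=1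
        and b="\<lambda>i j. [[0, 1], [1, 0]] ! i ! j" and k=1 and \<tau>=1
        and ?p0.0=0 and ?p1.0=1, OF _ _ E])
      (simp_all add: atMost_Suc)
qed

lemma perfect_state_transfer_C4:
  assumes "graph_iso G (cycle_graph 4)"
  shows "perfect_state_transfer G"
proof -
  obtain h where bij: "bij_betw h (pverts G) {..<4}"
    and arcs: "\<And>x y. x \<in> pverts G \<Longrightarrow> y \<in> pverts G \<Longrightarrow> (x, y) \<in> parcs G \<longleftrightarrow> (h x, h y) \<in> parcs (cycle_graph 4)"
    using graph_isoE[OF assms] pair_wf_digraph by (auto simp: cycle_graph_def)
  have ws: "{..<4} = set [0, 1, 2, 3 :: nat]" by auto
  have E: "(x, y) \<in> parcs G \<longleftrightarrow> h y = (h x + 1) mod 4 \<or> h x = (h y + 1) mod 4"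
    if "x \<in> pverts G" "y \<in> pverts G" for x y
    using arcs[OF that] bij that by (auto simp: cycle_graph_def bij_betw_def)
  \<comment> \<open>Intersection numbers of the distance partition from vertex 0, whose last cell is
    the antipode 2; the transfer takes two steps.\<close>
  let ?b = "\<lambda>i j. [[0, 2, 0], [1, 0, 1], [0, 2, 0]] ! i ! j :: nat"
  have walk: "\<forall>i\<in>{..2}. \<forall>j\<in>{..2}. 0 < ?b i j \<longrightarrow> quotient_walk 2 2 ?b 2 i j = (if j = 2 then 1 else 0)"
    by (simp add: atMost_Suc numeral_3_eq_3 numeral_2_eq_2)
  show ?thesis
    using bij unfolding ws
    by (rule perfect_state_transfer_quotient[where
        E="\<lambda>p q. q = (p + 1) mod 4 \<or> p = (q + 1) mod 4" and n=2 and c="\<lambda>i. [0, 1, 2, 1] ! i" and m=2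
        and b="?b" and k=2 and \<tau>=2 and ?p0.0=0 and ?p1.0=2, OF _ _ E _ _ _ _ _ _ _ _ _ walk])
      (assumption | code_simp)+
qed

lemma perfect_state_transfer_C6:
  assumes "graph_iso G (cycle_graph 6)"
  shows "perfect_state_transfer G"
proof -
  obtain h where bij: "bij_betw h (pverts G) {..<6}"
    and arcs: "\<And>x y. x \<in> pverts G \<Longrightarrow> y \<in> pverts G \<Longrightarrow> (x, y) \<in> parcs G \<longleftrightarrow> (h x, h y) \<in> parcs (cycle_graph 6)"
    using graph_isoE[OF assms] pair_wf_digraph by (auto simp: cycle_graph_def)
  have ws: "{..<6} = set [0, 1, 2, 3, 4, 5 :: nat]" by auto
  have E: "(x, y) \<in> parcs G \<longleftrightarrow> h y = (h x + 1) mod 6 \<or> h x = (h y + 1) mod 6"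
    if "x \<in> pverts G" "y \<in> pverts G" for x y
    using arcs[OF that] bij that by (auto simp: cycle_graph_def bij_betw_def)
  \<comment> \<open>The distance partition from vertex 0, ending in the antipode 3, with transfer in
    three steps.\<close>
  let ?b = "\<lambda>i j. [[0, 2, 0, 0], [1, 0, 1, 0], [0, 1, 0, 1], [0, 0, 2, 0]] ! i ! j :: nat"
  have walk: "\<forall>i\<in>{..3}. \<forall>j\<in>{..3}. 0 < ?b i j \<longrightarrow> quotient_walk 2 3 ?b 3 i j = (if j = 3 then 1 else 0)"
    by (simp add: atMost_Suc numeral_3_eq_3 numeral_2_eq_2)
  show ?thesis
    using bij unfolding ws
    by (rule perfect_state_transfer_quotient[where
        E="\<lambda>p q. q = (p + 1) mod 6 \<or> p = (q + 1) mod 6" and n=3 and c="\<lambda>i. [0, 1, 2, 3, 2, 1] ! i" and m=3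
        and b="?b" and k=2 and \<tau>=3 and ?p0.0=0 and ?p1.0=3, OF _ _ E _ _ _ _ _ _ _ _ _ walk])
      (assumption | code_simp)+
qed

lemma perfect_state_transfer_K222:
  assumes "graph_iso G (complete_multipartite_graph [2, 2, 2])"
  shows "perfect_state_transfer G"
proof -
  let ?ws = "[(0, 0), (0, 1), (1, 0), (1, 1), (2, 0), (2, 1)] :: (nat \<times> nat) list"
  let ?H = "complete_multipartite_graph [2, 2, 2]"
  obtain h where bij: "bij_betw h (pverts G) (pverts ?H)"
    and arcs: "\<And>x y. x \<in> pverts G \<Longrightarrow> y \<in> pverts G \<Longrightarrow> (x, y) \<in> parcs G \<longleftrightarrow> (h x, h y) \<in> parcs ?H"
    using graph_isoE[OF assms] pair_wf_digraph by blast
  have ws: "pverts ?H = set ?ws"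
    by (auto simp: complete_multipartite_graph_def numeral_3_eq_3 numeral_2_eq_2 less_Suc_eq)
  have E: "(x, y) \<in> parcs G \<longleftrightarrow> fst (h x) \<noteq> fst (h y)"
    if "x \<in> pverts G" "y \<in> pverts G" for x y
  proof -
    have "h x \<in> pverts ?H" "h y \<in> pverts ?H" using bij that by (auto simp: bij_betw_def)
    then show ?thesis using arcs[OF that] by (simp add: complete_multipartite_graph_def Let_def)
  qed
  \<comment> \<open>The distance partition from \<open>(0, 0)\<close>: the source, the four vertices
    of the other two parts, and the target \<open>(0, 1)\<close>.\<close>
  let ?b = "\<lambda>i j. [[0, 4, 0], [1, 2, 1], [0, 4, 0]] ! i ! j :: nat"
  define q where "q = quotient_walk 4 2 ?b"
  \<comment> \<open>Recurrences are kept only for pairs of cells joined by arcs; the factor 2/k is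
    1/2.\<close>
  have step: "q 0 i j = (if j = 0 then 1 else 0)"
    "q (Suc t) 0 1 = q t 1 0"
    "q (Suc t) 1 0 = (q t 0 1 + 2 * q t 1 1 + q t 2 1) / 2 - q t 0 1"
    "q (Suc t) 1 1 = (q t 0 1 + 2 * q t 1 1 + q t 2 1) / 2 - q t 1 1"
    "q (Suc t) 1 2 = (q t 0 1 + 2 * q t 1 1 + q t 2 1) / 2 - q t 2 1"
    "q (Suc t) 2 1 = q t 1 2" for t i j
    unfolding q_def by (simp_all add: atMost_Suc numeral_2_eq_2)
  have q: "q 6 0 1 = 0" "q 6 1 0 = 0" "q 6 1 1 = 0" "q 6 1 2 = 1" "q 6 2 1 = 0"
  proof -
    have six: "6 = Suc (Suc (Suc (Suc (Suc (Suc 0)))))" by simp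
    show "q 6 0 1 = 0" "q 6 1 0 = 0" "q 6 1 1 = 0" "q 6 1 2 = 1" "q 6 2 1 = 0"
      unfolding six by (simp_all only: step) simp_all
  qed
  show ?thesis
    using bij unfolding ws
  proof (rule perfect_state_transfer_quotient[where E="\<lambda>p q. fst p \<noteq> fst q" and n=2 and m=2
        and c="\<lambda>p. if fst p = 0 then 2 * snd p else 1" and b="?b" and k=4 and \<tau>=6
        and ?p0.0="(0, 0)" and ?p1.0="(0, 1)", OF _ _ E])
    show "\<forall>i\<in>{..2}. \<forall>j\<in>{..2}. 0 < ?b i j \<longrightarrow> quotient_walk 4 2 ?b 6 i j = (if j = 2 then 1 else 0)"
      using q unfolding q_def[symmetric] by (simp add: atMost_Suc numeral_2_eq_2)
  qed (assumption | code_simp)+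
qed

end

section \<open>Classification\<close>

lemma lessThan_4: "{..<4} = {0, 1, 2, 3 :: nat}" and lessThan_6: "{..<6} = {0, 1, 2, 3, 4, 5 :: nat}"
  by auto

lemma graph_iso_nthI:
  assumes "pair_wf_digraph G"
    and vs: "distinct vs" "set vs = pverts G" and ws: "distinct ws" "set ws = pverts H"
    and len: "length vs = n" "length ws = n"
    and arcs: "\<forall>i\<in>{..<n}. \<forall>j\<in>{..<n}. (vs ! i, vs ! j) \<in> parcs G \<longleftrightarrow> (ws ! i, ws ! j) \<in> parcs H"
    and H: "parcs H \<subseteq> pverts H \<times> pverts H"
  shows "graph_iso G H"
proof -
  let ?p = "inv_into {..<n} ((!) vs)"
  have bv: "bij_betw ((!) vs) {..<n} (pverts G)" and bw: "bij_betw ((!) ws) {..<n} (pverts H)"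
    using vs ws len by (auto intro: bij_betw_nth)
  have inv: "bij_betw ?p (pverts G) {..<n}" using bv by (rule bij_betw_inv_into)
  have p: "?p x \<in> {..<n}" "vs ! ?p x = x" if "x \<in> pverts G" for x
    using inv bij_betw_inv_into_right[OF bv that] that by (auto simp: bij_betw_def)
  show ?thesis
  proof (rule graph_isoI[OF assms(1) _ _ H])
    show "bij_betw ((!) ws \<circ> ?p) (pverts G) (pverts H)"
      using inv bw by (rule bij_betw_trans)
    fix x y assume "x \<in> pverts G" "y \<in> pverts G"
    then show "(x, y) \<in> parcs G \<longleftrightarrow> (((!) ws \<circ> ?p) x, ((!) ws \<circ> ?p) y) \<in> parcs H"
      using arcs p by (metis comp_apply)
  qed
qed

locale distance_regular_transfer = distance_regular_graph G + integral_involutive_transfer G k \<tau> \<sigma>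
  for G :: "'a pair_pre_digraph" and k \<tau> \<sigma> +
  assumes \<sigma>_neq: "x \<in> pverts G \<Longrightarrow> \<sigma> x \<noteq> x"
    and \<sigma>_unique: "x \<in> pverts G \<Longrightarrow> y \<in> pverts G \<Longrightarrow> dist x y = dist x (\<sigma> x) \<Longrightarrow> y = \<sigma> x"
    and nonempty: "pverts G \<noteq> {}"
begin

lemma \<sigma>_eq_iff: "x \<in> V \<Longrightarrow> y \<in> V \<Longrightarrow> \<sigma> x = y \<longleftrightarrow> x = \<sigma> y"
  using \<sigma>_\<sigma> by metis

lemma \<sigma>_inj_iff: "x \<in> V \<Longrightarrow> y \<in> V \<Longrightarrow> \<sigma> x = \<sigma> y \<longleftrightarrow> x = y"
  using \<sigma>_\<sigma> by metis

text \<open>The graph is connected, and walks from \<open>y\<close> cannot leave a set closed under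
  neighbours.\<close>

lemma closed_eq_V:
  assumes "S \<subseteq> V" "y \<in> S" "\<And>x. x \<in> S \<Longrightarrow> nbrs x \<subseteq> S"
  shows "V = S"
proof -
  have "v \<in> S" if "(y, v) \<in> parcs G ^^ n" for v n
    using that by (induction n arbitrary: v) (use assms in auto)
  then show ?thesis
    using relpow_dist assms(1,2) by blast
qed

text \<open>Applying an operator identity to this indicator reads off the column of
  \<open>y\<close>.\<close>

definition delta :: "'a \<Rightarrow> 'a \<Rightarrow> complex" where
  "delta y x = (if x = y then 1 else 0)"

lemma adj_delta: "adj (delta y) x = (if (x, y) \<in> parcs G then 1 else 0)"
  by (simp add: adj_def delta_def)

lemma adj_delta_\<sigma>:
  assumes "y \<in> V"
  shows "adj (\<lambda>z. delta y (\<sigma> z)) x = (if (x, \<sigma> y) \<in> parcs G then 1 else 0)"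
proof -
  have "adj (\<lambda>z. delta y (\<sigma> z)) x = adj (delta (\<sigma> y)) x"
    by (rule adj_cong) (use assms \<sigma>_\<sigma> in \<open>force simp: delta_def\<close>)
  then show ?thesis by (simp add: adj_delta)
qed

lemma adj_adj_delta: "adj (adj (delta y)) x = of_nat (card (nbrs x \<inter> nbrs y))"
proof -
  have "adj (adj (delta y)) x = (\<Sum>w\<in>nbrs x. if w \<in> nbrs y then 1 else 0)"
    unfolding adj_def[of "adj (delta y)"] adj_delta
    by (intro sum.cong refl) (auto intro: arcs_symmetric)
  also have "\<dots> = of_nat (card {w \<in> nbrs x. w \<in> nbrs y})"
    by (subst sum.inter_filter[symmetric]) simp_all
  finally show ?thesis by (simp only: Int_def)
qed

section \<open>Even transfer time: twins and the cocktail party graph\<close>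

lemma twin:
  assumes "even \<tau>" "x \<in> V" "y \<in> V"
  shows "(x, \<sigma> y) \<in> parcs G \<longleftrightarrow> (x, y) \<in> parcs G"
  \<comment> \<open>The matrix entry of the operator identity at row \<open>x\<close> and column
    \<open>y\<close>.\<close>
  using adj_\<sigma>_even[OF assms(1,2), of "delta y"] assms(3)
  by (auto simp: adj_delta adj_delta_\<sigma> split: if_splits)

lemma nbrs_nonempty: "x \<in> V \<Longrightarrow> nbrs x \<noteq> {}"
  using degree[of x] k_pos by (metis card.empty less_numeral_extra(3))

text \<open>For even \<open>\<tau>\<close> the graph is a cocktail party graph: every vertex is adjacent to all others
  but its twin.\<close>

lemma V_even:
  assumes even: "even \<tau>" and y: "y \<in> V"
  shows "V = insert y (insert (\<sigma> y) (nbrs y))"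
proof (rule closed_eq_V)
  have nadj: "(y, \<sigma> y) \<notin> parcs G"
    using twin[OF even y y] no_loops' by blast
  \<comment> \<open>A neighbour of \<open>y\<close> is adjacent to the twin as well, so the twin is
    at distance exactly 2.\<close>
  obtain x where x: "x \<in> nbrs y" using nbrs_nonempty[OF y] by blast
  then have "x \<in> V" using nbrs_subset by blast
  then have "(x, \<sigma> y) \<in> parcs G" using twin[OF even _ y] x arcs_symmetric by auto
  then have path: "(y, \<sigma> y) \<in> parcs G ^^ 2"
    using x by (auto simp: numeral_2_eq_2)
  have "dist y (\<sigma> y) \<le> 2" by (rule dist_le[OF y path])
  moreover have "dist y (\<sigma> y) \<noteq> 0" using dist_eq_0_iff[OF y \<sigma>_in[OF y]] \<sigma>_neq[OF y] by metis
  moreover have "dist y (\<sigma> y) \<noteq> 1" using dist_eq_1_iff[OF y \<sigma>_in[OF y]] nadj by simp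
  ultimately have d2: "dist y (\<sigma> y) = 2" by linarith
  fix x assume "x \<in> insert y (insert (\<sigma> y) (nbrs y))"
  \<comment> \<open>Neighbours of the twin are neighbours of \<open>y\<close>. Neighbours of a
    neighbour lie within distance 2, and by \<open>\<sigma>_unique\<close> only the twin has
    distance 2.\<close>
  then consider "x = y" | "x = \<sigma> y" | "x \<in> nbrs y" by blast
  then show "nbrs x \<subseteq> insert y (insert (\<sigma> y) (nbrs y))"
  proof cases
    case 2
    show ?thesis
    proof
      fix z assume "z \<in> nbrs x"
      then have "(z, \<sigma> y) \<in> parcs G" "z \<in> V"
        using 2 nbrs_subset by (auto intro: arcs_symmetric)
      then show "z \<in> insert y (insert (\<sigma> y) (nbrs y))"
        using twin[OF even _ y, of z] by (auto intro: arcs_symmetric)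
    qed
  next
    case 3
    show ?thesis
    proof
      fix z assume z: "z \<in> nbrs x"
      then have zV: "z \<in> V" using nbrs_subset by blast
      have "(y, z) \<in> parcs G ^^ 2" using 3 z by (auto simp: numeral_2_eq_2)
      then have "dist y z \<le> 2" by (rule dist_le[OF y])
      then consider "dist y z = 0" | "dist y z = 1" | "dist y z = 2" by linarith
      then show "z \<in> insert y (insert (\<sigma> y) (nbrs y))"
      proof cases
        case 1
        then show ?thesis using dist_eq_0_iff[OF y zV] by simp
      next
        case 2
        then show ?thesis using dist_eq_1_iff[OF y zV] by simp
      next
        case 3
        then show ?thesis using \<sigma>_unique[OF y zV] d2 by simp
      qed
    qed
  qed blast
qed (use y \<sigma>_in nbrs_subset in auto)

lemma adjacent_even:
  assumes even: "even \<tau>" and xy: "x \<in> V" "y \<in> V"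
  shows "(x, y) \<in> parcs G \<longleftrightarrow> y \<noteq> x \<and> y \<noteq> \<sigma> x"
  using V_even[OF even xy(1)] xy(2) twin[OF even xy(1,1)] no_loops' by blast

lemma card_V_even:
  assumes even: "even \<tau>"
  shows "card V = k + 2"
proof -
  obtain y where y: "y \<in> V" using nonempty by blast
  have "y \<notin> nbrs y" "\<sigma> y \<notin> nbrs y" "\<sigma> y \<noteq> y"
    using adjacent_even[OF even y] y \<sigma>_in \<sigma>_neq by auto
  then have "card (insert y (insert (\<sigma> y) (nbrs y))) = k + 2"
    using degree[OF y] finite_nbrs[of y] by simp
  then show ?thesis using V_even[OF even y] by (simp only:)
qed

text \<open>The difference of the indicators of two twin pairs is an eigenvector for \<open>-2\<close>, which therefore
  has to be one of \<open>0\<close>, \<open>\<plusminus> k / 2\<close>, \<open>\<plusminus> k\<close>.\<close>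

lemma degree_even:
  assumes even: "even \<tau>"
  shows "k = 2 \<or> k = 4"
proof -
  obtain y where y: "y \<in> V" using nonempty by blast
  obtain z where z: "z \<in> nbrs y" using nbrs_nonempty[OF y] by blast
  then have zV: "z \<in> V" using nbrs_subset by blast
  have neq: "z \<noteq> y" "z \<noteq> \<sigma> y" using adjacent_even[OF even y zV] z by auto
  then have neq': "\<sigma> z \<noteq> y" "\<sigma> z \<noteq> \<sigma> y" using \<sigma>_\<sigma> y zV by metis+
  define f :: "'a \<Rightarrow> complex" where
    "f = (\<lambda>w. (if w = y \<or> w = \<sigma> y then 1 else 0) - (if w = z \<or> w = \<sigma> z then 1 else 0))"
  have f\<sigma>: "f (\<sigma> w) = f w" if "w \<in> V" for w
    using that y zV by (simp add: f_def \<sigma>_eq_iff \<sigma>_inj_iff disj_commute)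
  have "(\<Sum>w\<in>V. f w) = of_nat (card {y, \<sigma> y}) - of_nat (card {z, \<sigma> z})"
  proof -
    have ind: "(\<Sum>w\<in>V. if w = p \<or> w = q then 1 else 0 :: complex) = of_nat (card {p, q})"
      if "p \<in> V" "q \<in> V" for p q
    proof -
      have "{w \<in> V. w = p \<or> w = q} = {p, q}" using that by blast
      then show ?thesis
        using sum.inter_filter[OF pair_finite_verts, of "\<lambda>_. 1 :: complex" "\<lambda>w. w = p \<or> w = q"] by simp
    qed
    show ?thesis
      unfolding f_def sum_subtractf ind[OF y \<sigma>_in[OF y]] ind[OF zV \<sigma>_in[OF zV]] ..
  qed
  also have "\<dots> = 0" using \<sigma>_neq[OF y, symmetric] \<sigma>_neq[OF zV, symmetric] by simp
  finally have total: "(\<Sum>w\<in>V. f w) = 0" .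
  have "adj f x = -2 * f x" if x: "x \<in> V" for x
  proof -
    \<comment> \<open>A neighbourhood omits exactly one twin pair, so the vanishing total leaves
      minus the sum over that pair.\<close>
    have "nbrs x = V - {x, \<sigma> x}"
      using adjacent_even[OF even x] nbrs_subset by blast
    then have "adj f x = (\<Sum>w\<in>V. f w) - (\<Sum>w\<in>{x, \<sigma> x}. f w)"
      unfolding adj_def using x \<sigma>_in pair_finite_verts by (simp only:) (intro sum_diff, auto)
    also have "(\<Sum>w\<in>{x, \<sigma> x}. f w) = 2 * f x"
      using \<sigma>_neq[OF x, symmetric] f\<sigma>[OF x] by simp
    finally show ?thesis using total by simp
  qed
  moreover have "f y \<noteq> 0" using neq neq' by (auto simp: f_def)
  ultimately have "2 * (-2) / of_nat k \<in> {-2, -1, 0, 1, 2 :: complex}"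
    using y by (intro eigenvalue_cases) auto
  \<comment> \<open>Over the integers the condition becomes \<open>i * int k = -4\<close>;
    positivity of \<open>k\<close> leaves only -2 and -1 for \<open>i\<close>.\<close>
  then have "2 * (-2) / of_nat k \<in> (of_int ` {-2, -1, 0, 1, 2} :: complex set)"
    by simp
  then obtain i :: int where i: "i \<in> {-2, -1, 0, 1, 2}" "2 * (-2) / of_nat k = (of_int i :: complex)"
    by blast
  have "of_int (i * int k) = (2 * (-2) / of_nat k) * (of_nat k :: complex)"
    by (simp only: i(2) of_int_mult of_int_of_nat_eq)
  also have "\<dots> = of_int (-4)" using k_pos by simp
  finally have "i * int k = -4" by (simp only: of_int_eq_iff)
  then show ?thesis using i(1) by auto
qed

lemma graph_iso_even:
  assumes even: "even \<tau>"
  shows "graph_iso G (cycle_graph 4) \<or> graph_iso G (complete_multipartite_graph [2, 2, 2])"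
proof -
  obtain y where y: "y \<in> V" using nonempty by blast
  obtain z where z: "z \<in> nbrs y" using nbrs_nonempty[OF y] by blast
  then have zV: "z \<in> V" using nbrs_subset by blast
  have neq: "z \<noteq> y" "z \<noteq> \<sigma> y" using adjacent_even[OF even y zV] z by auto
  have in4: "{y, \<sigma> y, z, \<sigma> z} \<subseteq> V" using y zV \<sigma>_in by auto
  note s = \<sigma>_\<sigma>[OF y] \<sigma>_\<sigma>[OF zV] \<sigma>_neq[OF y] \<sigma>_neq[OF zV]
  have d4: "distinct [y, z, \<sigma> y, \<sigma> z]" using neq s y zV by (auto simp: \<sigma>_eq_iff \<sigma>_inj_iff)
  have "set [y, z, \<sigma> y, \<sigma> z] = {y, \<sigma> y, z, \<sigma> z}" by auto
  then have c4: "card {y, \<sigma> y, z, \<sigma> z} = 4" using distinct_card[OF d4] by (simp only:) simp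
  show ?thesis
    using degree_even[OF even]
  proof
    assume "k = 2"
    then have V: "V = {y, \<sigma> y, z, \<sigma> z}"
      using card_V_even[OF even] c4 in4 pair_finite_verts by (intro card_subset_eq[symmetric]) auto
    have "graph_iso G (cycle_graph 4)"
    proof (rule graph_iso_nthI[where vs="[y, z, \<sigma> y, \<sigma> z]" and ws="[0, 1, 2, 3]" and n=4])
      show "\<forall>i\<in>{..<4}. \<forall>j\<in>{..<4}. ([y, z, \<sigma> y, \<sigma> z] ! i, [y, z, \<sigma> y, \<sigma> z] ! j) \<in> parcs G \<longleftrightarrow>
          ([0, 1, 2, 3] ! i, [0, 1, 2, 3] ! j) \<in> parcs (cycle_graph 4)"
        using d4 distinct_rev[THEN iffD2, OF d4] s(1,2) y zV \<sigma>_in[OF y] \<sigma>_in[OF zV]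
        by (simp add: lessThan_4 adjacent_even[OF even] cycle_graph_def)
    qed (use d4 V in \<open>auto simp: cycle_graph_def\<close>)
    then show ?thesis ..
  next
    assume "k = 4"
    \<comment> \<open>Six vertices leave room for a third twin pair, and the three pairs become the
      parts.\<close>
    then have "\<not> V \<subseteq> {y, \<sigma> y, z, \<sigma> z}"
      using card_V_even[OF even] c4 card_mono[of "{y, \<sigma> y, z, \<sigma> z}" V] by auto
    then obtain w where w: "w \<in> V" "w \<notin> {y, \<sigma> y, z, \<sigma> z}" by blast
    note s' = s \<sigma>_\<sigma>[OF w(1)] \<sigma>_neq[OF w(1)]
    let ?vs = "[y, \<sigma> y, z, \<sigma> z, w, \<sigma> w]"
    let ?ws = "[(0, 0), (0, 1), (1, 0), (1, 1), (2, 0), (2, 1)] :: (nat \<times> nat) list"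
    have "\<sigma> w \<noteq> y" "\<sigma> w \<noteq> \<sigma> y" "\<sigma> w \<noteq> z" "\<sigma> w \<noteq> \<sigma> z"
      using w y zV by (auto simp: \<sigma>_eq_iff \<sigma>_inj_iff)
    then have d6: "distinct ?vs"
      using d4 w(2) \<sigma>_neq[OF w(1)] by (simp add: eq_commute[of "\<sigma> y" z] eq_commute[of w "\<sigma> w"]) metis
    have "set ?vs = V"
      using distinct_card[OF d6] card_V_even[OF even] \<open>k = 4\<close> in4 w(1) \<sigma>_in pair_finite_verts
      by (intro card_subset_eq) auto
    moreover have "set ?ws = pverts (complete_multipartite_graph [2, 2, 2])"
      by (auto simp: complete_multipartite_graph_def numeral_3_eq_3 numeral_2_eq_2 less_Suc_eq)
    moreover have "\<forall>i\<in>{..<6}. \<forall>j\<in>{..<6}. (?vs ! i, ?vs ! j) \<in> parcs G \<longleftrightarrow>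
        (?ws ! i, ?ws ! j) \<in> parcs (complete_multipartite_graph [2, 2, 2])"
      using d6 distinct_rev[THEN iffD2, OF d6] s' y zV w(1) \<sigma>_in[OF y] \<sigma>_in[OF zV] \<sigma>_in[OF w(1)]
      by (simp add: lessThan_6 adjacent_even[OF even] complete_multipartite_graph_def)
    ultimately have "graph_iso G (complete_multipartite_graph [2, 2, 2])"
      using d6 pair_wf_digraph
      by (intro graph_iso_nthI[where vs="?vs" and ws="?ws" and n=6])
        (auto simp: complete_multipartite_graph_def Let_def)
    then show ?thesis ..
  qed
qed

section \<open>Odd transfer time: the single edge and the hexagon\<close>

lemma common_neighbours_odd:
  assumes odd: "odd \<tau>" and xy: "x \<in> V" "y \<in> V"
  shows "2 * card (nbrs x \<inter> nbrs y) =
    (if (x, \<sigma> y) \<in> parcs G then k else 0) + (if x = y then k\<^sup>2 else 0)"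
proof -
  \<comment> \<open>The entry of \<open>adj_adj_odd\<close> at row \<open>x\<close> and column
    \<open>y\<close>, doubled to stay within the natural numbers.\<close>
  have "of_nat (2 * card (nbrs x \<inter> nbrs y)) =
      (of_nat ((if (x, \<sigma> y) \<in> parcs G then k else 0) + (if x = y then k\<^sup>2 else 0)) :: complex)"
    using adj_adj_odd[OF odd xy(1), of "delta y"]
    unfolding adj_adj_delta adj_delta_\<sigma>[OF xy(2)] by (simp add: delta_def)
  then show ?thesis by (simp only: of_nat_eq_iff)
qed

text \<open>The diagonal entry reads 2k = k^2, or 2k = k + k^2 if \<open>y\<close> is adjacent to
  its image; the latter gives \<open>k = 1\<close>.\<close>

lemma degree_odd:
  assumes odd: "odd \<tau>" and y: "y \<in> V"
  shows "k = 1 \<or> k = 2 \<and> (y, \<sigma> y) \<notin> parcs G"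
proof -
  have "2 * k = (if (y, \<sigma> y) \<in> parcs G then k else 0) + k\<^sup>2"
    using common_neighbours_odd[OF odd y y] degree[OF y] by simp
  then show ?thesis
    using k_pos by (auto simp: power2_eq_square split: if_splits)
qed

lemma graph_iso_odd_K2:
  assumes "k = 1"
  shows "graph_iso G (complete_graph 2)"
proof -
  obtain y where y: "y \<in> V" using nonempty by blast
  obtain z where z: "nbrs y = {z}" using degree[OF y] assms by (auto simp: card_1_singleton_iff)
  then have yz: "(y, z) \<in> parcs G" "(z, y) \<in> parcs G" "z \<in> V"
    using nbrs_subset by (auto intro: arcs_symmetric)
  obtain z' where z': "nbrs z = {z'}" using degree[OF yz(3)] assms by (auto simp: card_1_singleton_iff)
  moreover have "y \<in> nbrs z" using yz by blast
  ultimately have "nbrs z = {y}" by (metis singletonD)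
  then have V: "V = {y, z}"
    using y yz z by (intro closed_eq_V[where y=y]) auto
  have neq: "y \<noteq> z" using yz no_loops' by blast
  show ?thesis
  proof (rule graph_iso_nthI[where vs="[y, z]" and ws="[0, 1]" and n=2])
    show "\<forall>i\<in>{..<2}. \<forall>j\<in>{..<2}. ([y, z] ! i, [y, z] ! j) \<in> parcs G \<longleftrightarrow>
          ([0, 1] ! i, [0, 1] ! j) \<in> parcs (complete_graph 2)"
      using yz no_loops'
      by (auto simp add: lessThan_Suc numeral_2_eq_2 complete_graph_def)
  qed (use neq V in \<open>auto simp: complete_graph_def\<close>)
qed

text \<open>The vertices \<open>y\<close> and \<open>c\<close> share the neighbour \<open>a\<close>,
  so the off-diagonal identity makes \<open>y\<close> adjacent to \<open>\<sigma> c\<close>. For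
  \<open>k = 2\<close> the vertex \<open>c\<close> is not adjacent to its own image, which excludes
  \<open>a\<close>.\<close>

lemma antipode_odd:
  assumes odd: "odd \<tau>" "k = 2"
    and nb: "y \<in> V" "nbrs y = {a, b}" "nbrs a = {y, c}" "c \<noteq> y"
  shows "\<sigma> c = b"
proof -
  have c: "c \<in> V" "(c, a) \<in> parcs G" and ya: "(y, a) \<in> parcs G"
    using nb nbrs_subset[of a] by (auto intro: arcs_symmetric)
  then have "a \<in> nbrs y \<inter> nbrs c" by simp
  then have "card (nbrs y \<inter> nbrs c) > 0" by (auto simp: card_gt_0_iff)
  then have "(y, \<sigma> c) \<in> parcs G"
    using common_neighbours_odd[OF odd(1) nb(1) c(1)] nb(4) by (auto split: if_splits)
  then have "\<sigma> c \<in> {a, b}" using nb(2) by blast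
  moreover have "\<sigma> c \<noteq> a" using degree_odd[OF odd(1) c(1)] odd(2) c(2) by auto
  ultimately show ?thesis by blast
qed

lemma graph_iso_odd_C6:
  assumes odd: "odd \<tau>" "k = 2"
  shows "graph_iso G (cycle_graph 6)"
proof -
  have other: "\<exists>q. nbrs x = {p, q} \<and> q \<noteq> p \<and> q \<in> V" if "(p, x) \<in> parcs G" for p x
  proof -
    have x: "x \<in> V" "p \<in> nbrs x" using that in_arcsD2 by (auto intro: arcs_symmetric)
    have "card (nbrs x) = 2" using degree[OF x(1)] odd(2) by simp
    then obtain q where "nbrs x = {p, q}" "q \<noteq> p"
      using x(2) unfolding card_2_iff by (metis doubleton_eq_iff insertE singletonD)
    then show ?thesis using nbrs_subset[of x] by blast
  qed
  obtain y where y: "y \<in> V" using nonempty by blast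
  then obtain a where ya: "(y, a) \<in> parcs G" using nbrs_nonempty by blast
  obtain b where b: "nbrs y = {a, b}" "b \<noteq> a" "b \<in> V" using other arcs_symmetric[OF ya] by blast
  have aV: "a \<in> V" using ya by (rule in_arcsD2)
  obtain c where c: "nbrs a = {y, c}" "c \<noteq> y" "c \<in> V" using other ya by blast
  have "(y, b) \<in> parcs G" using b by blast
  then obtain d where d: "nbrs b = {y, d}" "d \<noteq> y" "d \<in> V" using other by blast
  have "(a, c) \<in> parcs G" "(b, d) \<in> parcs G" using c d by blast+
  then obtain e e' where e: "nbrs c = {a, e}" "e \<noteq> a" "e \<in> V" and e': "nbrs d = {b, e'}" "e' \<noteq> b" "e' \<in> V"
    using other by metis
  \<comment> \<open>The path has grown from \<open>y\<close> in both directions, to \<open>e\<close>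
    and to \<open>e'\<close>. The antipode rule along it sends both of these to \<open>y\<close>, so
    they coincide and the hexagon closes.\<close>
  have \<sigma>c: "\<sigma> c = b" by (rule antipode_odd[OF odd y b(1) c(1,2)])
  have \<sigma>d: "\<sigma> d = a" using b(1) d by (intro antipode_odd[OF odd y, of b]) auto
  have \<sigma>e: "\<sigma> e = y" using c(1) e by (intro antipode_odd[OF odd aV, of c]) auto
  have "\<sigma> e' = y" using d(1) e' by (intro antipode_odd[OF odd b(3), of d]) auto
  then have "e' = e" using \<sigma>e \<sigma>_\<sigma> e(3) e'(3) by metis
  then have nd: "nbrs d = {b, e}" using e'(1) by simp
  have cd: "c \<noteq> d" using \<sigma>c \<sigma>d b(2) by blast
  have "(e, c) \<in> parcs G" "(e, d) \<in> parcs G" using e(1) nd arcs_symmetric by blast+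
  moreover obtain q where "nbrs e = {c, q}" using other e(1) by blast
  ultimately have ne: "nbrs e = {c, d}" using cd by auto
  have loopfree: "p \<notin> nbrs p" for p using no_loops' by blast
  \<comment> \<open>Inequalities come from the absence of loops, from \<sigma> having no fixed
    points, from the choice of second neighbours, and from \<open>cd\<close>.\<close>
  have dist6: "distinct [y, a, c, e, d, b]"
  proof -
    have "y \<noteq> a" "y \<noteq> b" using loopfree[of y] b(1) by auto
    moreover have "y \<noteq> e" using \<sigma>e \<sigma>_neq[OF y] by blast
    moreover have "a \<noteq> c" using loopfree[of a] c(1) by auto
    moreover have "a \<noteq> d" using \<sigma>d \<sigma>_neq[OF aV] by blast
    moreover have "c \<noteq> b" using \<sigma>c \<sigma>_neq[OF c(3)] by blast
    moreover have "c \<noteq> e" using loopfree[of c] e(1) by auto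
    moreover have "d \<noteq> e" "b \<noteq> e" using loopfree[of d] nd \<open>e' = e\<close> e'(2) by auto
    moreover have "b \<noteq> d" using loopfree[of b] d(1) by auto
    ultimately show ?thesis using b(2) c(2) d(2) e(2) cd by auto
  qed
  have V: "V = {y, a, c, e, d, b}"
    by (rule closed_eq_V[where y=y]) (use y aV b c d e nd ne in auto)
  let ?vs = "[y, a, c, e, d, b]"
  have adjacent: "(p, q) \<in> parcs G \<longleftrightarrow> q \<in> nbrs p" for p q by simp
  show ?thesis
  proof (rule graph_iso_nthI[where vs="?vs" and ws="[0, 1, 2, 3, 4, 5]" and n=6])
    show "\<forall>i\<in>{..<6}. \<forall>j\<in>{..<6}. (?vs ! i, ?vs ! j) \<in> parcs G \<longleftrightarrow>
        ([0, 1, 2, 3, 4, 5] ! i, [0, 1, 2, 3, 4, 5] ! j) \<in> parcs (cycle_graph 6)"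
      using dist6 distinct_rev[THEN iffD2, OF dist6] unfolding adjacent
      by (simp add: lessThan_6 cycle_graph_def b(1) c(1) d(1) e(1) nd ne del: Image_singleton_iff)
  qed (use dist6 V in \<open>auto simp: cycle_graph_def\<close>)
qed

lemma graph_iso_classification:
  "graph_iso G (complete_graph 2) \<or> graph_iso G (cycle_graph 4) \<or>
   graph_iso G (cycle_graph 6) \<or> graph_iso G (complete_multipartite_graph [2, 2, 2])"
proof (cases "even \<tau>")
  case True
  then show ?thesis using graph_iso_even by blast
next
  case False
  obtain y where "y \<in> V" using nonempty by blast
  then show ?thesis
    using degree_odd[OF False] graph_iso_odd_K2 graph_iso_odd_C6[OF False] by blast
qed

end

theorem theorem4p8:
  fixes G :: "'a pair_pre_digraph"
  assumes "pair_graph G"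
    and "integral_graph G"
    and "distance_regular G"
  shows "perfect_state_transfer G \<longleftrightarrow>
           graph_iso G (complete_graph 2) \<or>
           graph_iso G (cycle_graph 4) \<or>
           graph_iso G (cycle_graph 6) \<or>
           graph_iso G (complete_multipartite_graph [2, 2, 2])"
proof
  interpret pair_graph G by fact
  interpret distance_regular_graph G by unfold_locales fact
  assume pst: "perfect_state_transfer G"
  then have "pverts G \<noteq> {}" by (auto simp: perfect_state_transfer_def)
  from pst show "graph_iso G (complete_graph 2) \<or> graph_iso G (cycle_graph 4) \<or>
      graph_iso G (cycle_graph 6) \<or> graph_iso G (complete_multipartite_graph [2, 2, 2])"
  proof (rule perfect_state_transfer_involution)
    fix \<sigma> and \<tau> k :: nat
    assume "k > 0" "\<And>x. x \<in> pverts G \<Longrightarrow> card (nbrs x) = k" "\<tau> > 0"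
      "\<And>x. x \<in> pverts G \<Longrightarrow> \<sigma> x \<in> pverts G"
      "\<And>x. x \<in> pverts G \<Longrightarrow> \<sigma> (\<sigma> x) = x"
      "\<And>x. x \<in> pverts G \<Longrightarrow> \<sigma> x \<noteq> x"
      "\<And>x y. x \<in> pverts G \<Longrightarrow> y \<in> pverts G \<Longrightarrow> dist x y = dist x (\<sigma> x) \<longleftrightarrow> y = \<sigma> x"
      "\<And>x a. x \<in> pverts G \<Longrightarrow> a \<in> parcs G \<Longrightarrow> (grover (parcs G) ^^ \<tau>) (into x) a = into (\<sigma> x) a"
    then interpret distance_regular_transfer G k \<tau> \<sigma>
      using \<open>integral_graph G\<close> \<open>pverts G \<noteq> {}\<close> by unfold_locales blast+
    show ?thesis
      by (rule graph_iso_classification)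
  qed
next
  interpret pair_graph G by fact
  assume "graph_iso G (complete_graph 2) \<or> graph_iso G (cycle_graph 4) \<or>
      graph_iso G (cycle_graph 6) \<or> graph_iso G (complete_multipartite_graph [2, 2, 2])"
  then show "perfect_state_transfer G"
    using perfect_state_transfer_K2 perfect_state_transfer_C4 perfect_state_transfer_C6
      perfect_state_transfer_K222 by blast
qed

end
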